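(* Let $\alpha\in(0,1)$, $\lambda\in\mathbb{R}$, $x_0>0$, and consider the fractional ODE $D_c^\alpha X=\lambda X$, $X(0)=x_0$, whose solution is $X(t)=x_0E_\alpha(\lambda t^\alpha)$. For a time step $k>0$, with $t_n=nk$, consider the implicit scheme with $X_0=x_0$ and, for $n\ge1$, $$(\mathcal{D}^\alpha X)_n=\lambda X_n\iff X_n=X_0+\lambda k^\alpha\sum_{m=1}^na_{n-m}X_m.$$ (1) If $\lambda>0$ and $k^\alpha\lambda<c_0$, then $X(t_n)\le X_n\le X_{n+1}$ for all $n\ge0$. If $\lambda<0$, then $\lim_{n\to\infty}X_n=0$. (2) Let $\lambda>0$. Suppose $k_i$, $i=1,2$, satisfy $k_i^\alpha\lambda<c_0$ and $k_1=2^{m_1}k_2$ for some $m_1\in\mathbb{N}$. Let $\{X_n^{(i)}\}$ be the numerical solution with step $k_i$, and define the piecewise constant functions $\bar X_i(t)=X_n^{(i)}$ for $t\in(t_{n-1}^{(i)},t_n^{(i)}]$, where $t_n^{(i)}=nk_i$. Then $\bar X_1(t)\ge\bar X_2(t)$ for all $t>0$. Consequently, for every $T>0$ there exists a constant $C(\alpha,T)>0$ (which may depend on the fixed $\lambda$, but not on $k$) such that for any $k$ with $k^\alpha\lambda\le\frac12c_0$, $$\sup_{n:\,nk\le T}X_n\le C(\alpha,T)X_0.$$ (3) For every $T>0$ there is a constant $C_1(\alpha,T)$ (which may depend on the fixed $\lambda$ and $x_0$, but not on $k$) such that for all sufficiently small $k$, $$\sup_{n:\,nk\le T}|X_n-X(t_n)|\le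 C_1(\alpha,T)k^\alpha.$$
   Context: $D_c^\alpha$ is the Caputo derivative; the fractional ODE is equivalent to $X(t)=x_0+\frac{\lambda}{\Gamma(\alpha)}\int_0^t(t-s)^{\alpha-1}X(s)\,ds$. The Mittag-Leffler function is $E_\alpha(z)=\sum_{n=0}^\infty\frac{z^n}{\Gamma(n\alpha+1)}$. Discretization: $a_n=\frac{(n+1)^\alpha-n^\alpha}{\Gamma(1+\alpha)}$ for $n\ge0$; $a^{(-1)}$ is the convolution inverse of $a$, i.e. $a*a^{(-1)}=(1,0,0,\ldots)$ with $(p*q)_n=\sum_{m=0}^np_mq_{n-m}$; $c_0=a^{(-1)}_0=\Gamma(1+\alpha)$, $c_i=-a_i^{(-1)}$ for $i\ge1$, $c_n^n=c_0-\sum_{i=1}^{n-1}c_i$ for $n\ge1$; and $(\mathcal{D}^\alpha X)_n=k^{-\alpha}\big(c_0X_n-\sum_{i=1}^{n-1}c_iX_{n-i}-c_n^nX_0\big)$ for $n\ge1$. *)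

theory Defs
  imports "HOL-Analysis.Analysis"
begin

text \<open>
  The classical Caputo derivative for order \<open>0 < \<alpha> < 1\<close>. A solution of the initial value problem is
  continuous on \<open>[0, \<infinity>)\<close>, differentiable on \<open>(0, \<infinity>)\<close> (not necessarily at \<open>0\<close>, where typical
  solutions behave like \<open>t powr \<alpha>\<close>), and such that the Caputo derivative exists as a Lebesgue
  integral. The values of the integrand at the end points are immaterial.
\<close>

definition caputo_deriv :: "real \<Rightarrow> (real \<Rightarrow> real) \<Rightarrow> real \<Rightarrow> real" where
  "caputo_deriv \<alpha> X t =
     1 / Gamma (1 - \<alpha>) * integral {0..t} (\<lambda>s. deriv X s / (t - s) powr \<alpha>)"

definition fode_solution :: "real \<Rightarrow> real \<Rightarrow> real \<Rightarrow> (real \<Rightarrow> real) \<Rightarrow> bool" where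
  "fode_solution \<alpha> lam x0 X \<longleftrightarrow>
     X 0 = x0 \<and> continuous_on {0..} X \<and> (\<forall>t>0. X differentiable (at t)) \<and>
     (\<forall>t>0. (\<lambda>s. deriv X s / (t - s) powr \<alpha>) absolutely_integrable_on {0..t} \<and>
            caputo_deriv \<alpha> X t = lam * X t)"

definition mittag_leffler :: "real \<Rightarrow> real \<Rightarrow> real" where
  "mittag_leffler \<alpha> z = (\<Sum>n. z ^ n / Gamma (real n * \<alpha> + 1))"

definition exact_sol :: "real \<Rightarrow> real \<Rightarrow> real \<Rightarrow> real \<Rightarrow> real" where
  "exact_sol \<alpha> lam x0 t = x0 * mittag_leffler \<alpha> (lam * t powr \<alpha>)"

definition conv :: "(nat \<Rightarrow> real) \<Rightarrow> (nat \<Rightarrow> real) \<Rightarrow> nat \<Rightarrow> real" where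
  "conv p q n = (\<Sum>m=0..n. p m * q (n - m))"

definition conv_inverse :: "(nat \<Rightarrow> real) \<Rightarrow> nat \<Rightarrow> real" where
  "conv_inverse p = (THE q. conv p q = (\<lambda>n. if n = 0 then 1 else 0))"

lemma conv_eq_fps_mult: "conv p q n = fps_nth (Abs_fps p * Abs_fps q) n"
  by (simp add: conv_def fps_mult_nth)

lemma conv_inverse_eq_fps:
  assumes "p 0 \<noteq> 0"
  shows "conv_inverse p = fps_nth (inverse (Abs_fps p))"
    and "conv p (conv_inverse p) = (\<lambda>n. if n = 0 then 1 else 0)"
proof -
  have nz: "fps_nth (Abs_fps p) 0 \<noteq> 0" using assms by simp
  have iff: "conv p q = (\<lambda>n. if n = 0 then 1 else 0) \<longleftrightarrow> Abs_fps p * Abs_fps q = 1" for q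
    by (auto simp: fun_eq_iff fps_eq_iff conv_eq_fps_mult)
  have ex: "conv p (fps_nth (inverse (Abs_fps p))) = (\<lambda>n. if n = 0 then 1 else 0)"
    unfolding iff by (simp add: fps_nth_inverse inverse_mult_eq_1'[OF nz])
  have uniq: "q = fps_nth (inverse (Abs_fps p))"
    if "conv p q = (\<lambda>n. if n = 0 then 1 else 0)" for q
  proof -
    have "Abs_fps q = inverse (Abs_fps p)"
      using that unfolding iff by (metis fps_inverse_unique)
    then show ?thesis by (metis fps_nth_Abs_fps ext)
  qed
  show eq: "conv_inverse p = fps_nth (inverse (Abs_fps p))"
    unfolding conv_inverse_def using ex uniq by (rule the_equality)
  show "conv p (conv_inverse p) = (\<lambda>n. if n = 0 then 1 else 0)"
    unfolding eq by (rule ex)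
qed

definition coeff_a :: "real \<Rightarrow> nat \<Rightarrow> real" where
  "coeff_a \<alpha> n = ((real n + 1) powr \<alpha> - real n powr \<alpha>) / Gamma (1 + \<alpha>)"

definition coeff_c :: "real \<Rightarrow> nat \<Rightarrow> real" where
  "coeff_c \<alpha> i =
     (if i = 0 then conv_inverse (coeff_a \<alpha>) 0 else - conv_inverse (coeff_a \<alpha>) i)"

lemma coeff_c_0:
  assumes "0 < \<alpha>"
  shows "coeff_c \<alpha> 0 = Gamma (1 + \<alpha>)"
proof -
  have "Gamma (1 + \<alpha>) > 0" using assms by (intro Gamma_real_pos) simp
  then have "coeff_a \<alpha> 0 \<noteq> 0" by (simp add: coeff_a_def)
  from conv_inverse_eq_fps(1)[of "coeff_a \<alpha>", OF this] show ?thesis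
    by (simp add: coeff_c_def) (simp add: coeff_a_def)
qed

text \<open>The coefficient \<open>c\<^sub>n\<^sup>n\<close> multiplying the initial value.\<close>

definition coeff_c_init :: "real \<Rightarrow> nat \<Rightarrow> real" where
  "coeff_c_init \<alpha> n = coeff_c \<alpha> 0 - (\<Sum>i=1..<n. coeff_c \<alpha> i)"

definition discrete_caputo :: "real \<Rightarrow> real \<Rightarrow> (nat \<Rightarrow> real) \<Rightarrow> nat \<Rightarrow> real" where
  "discrete_caputo \<alpha> k X n =
     k powr (- \<alpha>) *
       (coeff_c \<alpha> 0 * X n - (\<Sum>i=1..<n. coeff_c \<alpha> i * X (n - i)) - coeff_c_init \<alpha> n * X 0)"

definition implicit_scheme :: "real \<Rightarrow> real \<Rightarrow> real \<Rightarrow> real \<Rightarrow> (nat \<Rightarrow> real) \<Rightarrow> bool" where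
  "implicit_scheme \<alpha> lam k x0 X \<longleftrightarrow>
     X 0 = x0 \<and> (\<forall>n\<ge>1. discrete_caputo \<alpha> k X n = lam * X n)"

text \<open>The value at \<open>t > 0\<close> is \<open>X n\<close> for the unique \<open>n \<ge> 1\<close> with \<open>t\<close> in \<open>((n - 1) k, n k]\<close>.\<close>

definition pw_const :: "real \<Rightarrow> (nat \<Rightarrow> real) \<Rightarrow> real \<Rightarrow> real" where
  "pw_const k X t = X (THE n. n \<ge> 1 \<and> t \<in> {(real n - 1) * k <.. real n * k})"

lemma pw_const_eq:
  assumes "0 < k" "n \<ge> 1" "t \<in> {(real n - 1) * k <.. real n * k}"
  shows "pw_const k X t = X n"
proof -
  have "m = n" if m: "m \<ge> 1" "t \<in> {(real m - 1) * k <.. real m * k}" for m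
  proof -
    have "(real m - 1) * k < real n * k" "(real n - 1) * k < real m * k"
      using m assms by (meson greaterThanAtMost_iff less_le_trans)+
    then have "real m - 1 < real n" "real n - 1 < real m"
      using \<open>0 < k\<close> by (simp_all only: mult_less_cancel_right_pos)
    then show ?thesis by linarith
  qed
  with assms have "(THE n. n \<ge> 1 \<and> t \<in> {(real n - 1) * k <.. real n * k}) = n"
    by (intro the_equality) blast+
  then show ?thesis by (simp add: pw_const_def)
qed

end

theory Submission
  imports Defs "HOL-Real_Asymp.Real_Asymp"
begin

text \<open>
  Everything is read off the Volterra forms \<open>X n = X 0 + h * (a * X) n\<close> and
  \<open>X = x0 + lam * J\<^sup>\<alpha> X\<close>. If \<open>h * a 0 < 1\<close>, a subsolution of the discrete equation lies below a
  supersolution. This yields monotonicity in \<open>n\<close> and in the step size, the lower bound by the exact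
  solution (which is nondecreasing, so its right-endpoint rule overestimates the fractional integral), and
  a discrete Gronwall inequality, with \<open>exp (\<mu> * t)\<close> as supersolution. For \<open>lam < 0\<close>, log-convexity of
  \<open>a\<close> makes the coefficients \<open>c\<close> nonnegative (Kaluza), so \<open>X\<close> decreases; as
  \<open>X 0 \<ge> \<bar>h\<bar> * X n * (a 0 + \<dots> + a (n - 1))\<close> and the sum diverges, \<open>X\<close> tends to \<open>0\<close>. The error bound is
  Gronwall applied to the consistency error, which is of order \<open>k powr \<alpha>\<close> because the exact solution is
  \<open>\<alpha>\<close>-Hoelder. A solution of the differential equation satisfies the Volterra equation by Fubini,
  and iterating that equation reproduces the Mittag-Leffler series with a vanishing remainder.
\<close>

section \<open>Comparison and the coefficients of the scheme\<close>

text \<open>Since \<open>a 0 = 1 / c 0\<close>, the step restriction says exactly that the diagonal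
  weight \<open>h * a 0\<close> of the implicit scheme stays below 1; this is what lets the
  comparison run as an induction on n. Up to the factor \<open>k powr \<alpha>\<close>, the weight
  \<open>a (n - m)\<close> is the exact integral over the m-th cell of the kernel of J^\<alpha>. The
  discrete and the continuous equation therefore differ only by freezing the solution at the right
  end of each cell, and the singularity of the kernel never has to be estimated. For negative
  \<open>lam\<close> the Volterra kernel has the wrong sign for this comparison. Decay is instead
  proved from the inverse kernel \<open>c\<close>, of which only the sign is used, and from the fact
  that \<open>a\<close> decreases. The uniform bound in (2) is derived from the Gronwall inequality
  rather than from the comparison of step sizes, because the error estimate needs the same
  inequality. An exponential serves there as supersolution: its values at shifted times factor, so
  the kernel sum reduces to one damped sum of the weights.\<close>

lemma convolution_sum_split_last:
  fixes a w :: "nat \<Rightarrow> real"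
  assumes "1 \<le> n"
  shows "(\<Sum>m=1..n. a (n - m) * w m) = a 0 * w n + (\<Sum>m=1..<n. a (n - m) * w m)"
proof -
  have "{1..n} = insert n {1..<n}" using assms by auto
  then show ?thesis by simp
qed

lemma convolution_sum_flip:
  fixes a w :: "nat \<Rightarrow> real"
  shows "(\<Sum>m=1..n. a (n - m) * w m) = (\<Sum>j<n. a j * w (n - j))"
  by (rule sum.reindex_bij_witness[where i="\<lambda>j. n - j" and j="\<lambda>m. n - m"]) auto

text \<open>In applications \<open>w\<close> is a subsolution minus a supersolution, so the forcing
  has cancelled. Earlier values are nonpositive by induction, and moving the diagonal term to the
  left leaves the positive factor \<open>1 - h * a 0\<close>. The bound \<open>N\<close> is there
  for inequalities known only up to a final time.\<close>

lemma discrete_comparison: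
  fixes a w :: "nat \<Rightarrow> real" and h :: real
  assumes a: "\<And>j. 0 \<le> a j" and h: "0 \<le> h" "h * a 0 < 1"
    and sub: "\<And>n. 1 \<le> n \<Longrightarrow> n \<le> N \<Longrightarrow> w n \<le> h * (\<Sum>m=1..n. a (n - m) * w m)"
    and n: "1 \<le> n" "n \<le> N"
  shows "w n \<le> 0"
  using n
proof (induction n rule: less_induct)
  case (less n)
  have "(\<Sum>m=1..<n. a (n - m) * w m) \<le> 0"
    using less by (intro sum_nonpos mult_nonneg_nonpos a) auto
  then have "h * (\<Sum>m=1..<n. a (n - m) * w m) \<le> 0"
    using h by (simp add: mult_nonneg_nonpos)
  with sub[OF less.prems] convolution_sum_split_last[OF less.prems(1), of a w]
  have "w n * (1 - h * a 0) \<le> 0" by (simp add: algebra_simps)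
  then show ?case using h by (simp add: mult_le_0_iff)
qed

section \<open>The weights \<open>a\<close>: sign, partial sums, monotonicity, log-convexity, and
  the sign of the reciprocal series\<close>

lemma coeff_a_pos:
  assumes "0 < \<alpha>"
  shows "0 < coeff_a \<alpha> n"
  using assms unfolding coeff_a_def
  by (intro divide_pos_pos Gamma_real_pos) (auto intro!: powr_less_mono2)

lemma coeff_a_0: "coeff_a \<alpha> 0 = 1 / Gamma (1 + \<alpha>)"
  by (simp add: coeff_a_def)

lemma sum_coeff_a: "(\<Sum>j<n. coeff_a \<alpha> j) = real n powr \<alpha> / Gamma (1 + \<alpha>)"
proof -
  have "(\<Sum>j<n. coeff_a \<alpha> j) = (\<Sum>j<n. real (Suc j) powr \<alpha> - real j powr \<alpha>) / Gamma (1 + \<alpha>)"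
    by (simp add: coeff_a_def sum_divide_distrib add.commute)
  then show ?thesis by (subst (asm) sum_lessThan_telescope) simp
qed

lemma coeff_a_decreasing:
  assumes "0 < \<alpha>" "\<alpha> < 1"
  shows "coeff_a \<alpha> (Suc n) \<le> coeff_a \<alpha> n"
proof -
  \<comment> \<open>Up to a factor, \<open>?f 0\<close> and \<open>?f 1\<close> are the negatives of
    the two weights. The derivative is inspected only on the open interval because for n = 0 it
    blows up at s = 0.\<close>
  let ?f = "\<lambda>s. (real n + s) powr \<alpha> - (real n + 1 + s) powr \<alpha>"
  have "?f 0 \<le> ?f 1"
  proof (rule DERIV_nonneg_imp_increasing_open[where f="?f"])
    fix s :: real assume s: "0 < s" "s < 1"
    have "(?f has_real_derivative \<alpha> * (real n + s) powr (\<alpha> - 1) - \<alpha> * (real n + 1 + s) powr (\<alpha> - 1)) (at s)"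
      using s by (auto intro!: derivative_eq_intros)
    moreover have "(real n + 1 + s) powr (\<alpha> - 1) \<le> (real n + s) powr (\<alpha> - 1)"
      using assms s by (intro powr_mono2') auto
    ultimately show "\<exists>y. (?f has_real_derivative y) (at s) \<and> 0 \<le> y"
      using assms by (auto intro!: exI simp: mult_left_mono)
  next
    show "continuous_on {0..1} ?f"
      using assms by (intro continuous_intros continuous_on_powr') auto
  qed auto
  then show ?thesis using assms
    by (simp add: coeff_a_def divide_right_mono add_ac)
qed

text \<open>The quadratic form with coefficients \<open>a\<^sub>n, a\<^sub>n\<^sub>+\<^sub>1, a\<^sub>n\<^sub>+\<^sub>2\<close> is nonnegative, because
  the kernel \<open>x powr (\<alpha> - 1)\<close> is log-convex.\<close>

lemma coeff_a_log_convex: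
  assumes "0 < \<alpha>" "\<alpha> < 1"
  shows "(coeff_a \<alpha> (Suc n))\<^sup>2 \<le> coeff_a \<alpha> n * coeff_a \<alpha> (Suc (Suc n))"
proof -
  let ?x = "real n"
  define G where "G = Gamma (1 + \<alpha>)"
  have G: "G > 0" using assms unfolding G_def by (intro Gamma_real_pos) auto
  \<comment> \<open>With this choice the quadratic form collapses to \<open>u\<close> times the
    difference in the claim, and \<open>u\<close> is positive.\<close>
  define u v where "u = coeff_a \<alpha> (Suc (Suc n))" and "v = - coeff_a \<alpha> (Suc n)"
  let ?f = "\<lambda>s. u\<^sup>2 * (?x + s) powr \<alpha> + 2 * u * v * (?x + 1 + s) powr \<alpha> + v\<^sup>2 * (?x + 2 + s) powr \<alpha>"
  have "?f 0 \<le> ?f 1"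
  proof (rule DERIV_nonneg_imp_increasing_open[where f="?f"])
    fix s :: real assume s: "0 < s" "s < 1"
    \<comment> \<open>The derivative is the same quadratic form with p, q, r as coefficients. It is
      nonnegative by completing the square once \<open>q * q \<le> p * r\<close>, which follows from
      (y + 1)^2 \<ge> y (y + 2) and the negative exponent \<alpha> - 1.\<close>
    define p q r where "p = (?x + s) powr (\<alpha> - 1)" and "q = (?x + 1 + s) powr (\<alpha> - 1)"
      and "r = (?x + 2 + s) powr (\<alpha> - 1)"
    have der: "(?f has_real_derivative \<alpha> * (u\<^sup>2 * p + 2 * u * v * q + v\<^sup>2 * r)) (at s)"
      using s by (auto intro!: derivative_eq_intros simp: p_def q_def r_def algebra_simps)
    have "q\<^sup>2 \<le> p * r"
    proof -
      have "q\<^sup>2 = ((?x + 1 + s) * (?x + 1 + s)) powr (\<alpha> - 1)"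
        using s by (simp add: q_def power2_eq_square powr_mult)
      also have "\<dots> \<le> ((?x + s) * (?x + 2 + s)) powr (\<alpha> - 1)"
      proof (intro powr_mono2')
        show "0 < (?x + s) * (?x + 2 + s)" using s by simp
        show "(?x + s) * (?x + 2 + s) \<le> (?x + 1 + s) * (?x + 1 + s)" by (simp add: algebra_simps)
      qed (use assms in simp)
      also have "\<dots> = p * r" using s by (simp add: p_def r_def powr_mult)
      finally show ?thesis .
    qed
    have pr: "p > 0" "r > 0" using s by (auto simp: p_def r_def)
    have "p * (u\<^sup>2 * p + 2 * u * v * q + v\<^sup>2 * r) = (u * p + v * q)\<^sup>2 + v\<^sup>2 * (p * r - q\<^sup>2)"
      by (simp add: power2_eq_square algebra_simps)
    also have "\<dots> \<ge> 0" using \<open>q\<^sup>2 \<le> p * r\<close> by simp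
    finally have "0 \<le> u\<^sup>2 * p + 2 * u * v * q + v\<^sup>2 * r" using pr by (simp add: zero_le_mult_iff)
    with assms have "0 \<le> \<alpha> * (u\<^sup>2 * p + 2 * u * v * q + v\<^sup>2 * r)" by simp
    with der show "\<exists>y. (?f has_real_derivative y) (at s) \<and> 0 \<le> y" by blast
  next
    show "continuous_on {0..1} ?f"
      using assms by (intro continuous_intros continuous_on_powr') auto
  qed auto
  moreover have "?f 1 - ?f 0 = G * (u\<^sup>2 * coeff_a \<alpha> n + 2 * u * v * coeff_a \<alpha> (Suc n) + v\<^sup>2 * coeff_a \<alpha> (Suc (Suc n)))"
    using G unfolding coeff_a_def G_def[symmetric] by (simp add: field_simps)
  ultimately have "0 \<le> G * (u\<^sup>2 * coeff_a \<alpha> n + 2 * u * v * coeff_a \<alpha> (Suc n) + v\<^sup>2 * coeff_a \<alpha> (Suc (Suc n)))"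
    by linarith
  with G have "0 \<le> u\<^sup>2 * coeff_a \<alpha> n + 2 * u * v * coeff_a \<alpha> (Suc n) + v\<^sup>2 * coeff_a \<alpha> (Suc (Suc n))"
    by (simp add: zero_le_mult_iff)
  also have "\<dots> = u * (coeff_a \<alpha> n * u - (coeff_a \<alpha> (Suc n))\<^sup>2)"
    by (simp add: u_def v_def power2_eq_square algebra_simps)
  finally show ?thesis
    using coeff_a_pos[OF assms(1), of "Suc (Suc n)"] by (simp add: u_def zero_le_mult_iff)
qed

text \<open>Log-convexity means that the ratios of consecutive terms increase; the cross-multiplied
  form is the one that appears as a coefficient in \<open>kaluza\<close>.\<close>

lemma log_convex_ratio_mono:
  fixes a :: "nat \<Rightarrow> real"
  assumes pos: "\<And>n. 0 < a n" and lc: "\<And>n. (a (Suc n))\<^sup>2 \<le> a n * a (Suc (Suc n))"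
    and "m \<le> n"
  shows "a (Suc m) * a n \<le> a (Suc n) * a m"
proof -
  have "a (Suc m) / a m \<le> a (Suc n) / a n"
    using \<open>m \<le> n\<close>
  proof (induction rule: dec_induct)
    case (step n)
    have "a (Suc n) / a n \<le> a (Suc (Suc n)) / a (Suc n)"
      using lc[of n] pos[of n] pos[of "Suc n"] by (simp add: field_simps power2_eq_square)
    with step show ?case by linarith
  qed simp
  then show ?thesis using pos[of n] pos[of m] by (simp add: field_simps)
qed

text \<open>Multiplying the convolution equation of index \<open>Suc n\<close> by
  \<open>a n\<close>, that of index \<open>n\<close> by \<open>a (Suc n)\<close>, and subtracting
  eliminates \<open>q 0\<close>, the only positive coefficient. What remains expresses
  \<open>a n * a 0 * q (Suc n)\<close> through the \<open>q i\<close> with 1 \<le> i \<le> n, which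
  are nonpositive by induction, with factors that are nonnegative since ratios increase. The case n
  = 0 is separate because the equation of index 0 has right-hand side 1.\<close>

lemma kaluza:
  fixes a q :: "nat \<Rightarrow> real"
  assumes pos: "\<And>n. 0 < a n" and lc: "\<And>n. (a (Suc n))\<^sup>2 \<le> a n * a (Suc (Suc n))"
    and q: "\<And>n. conv a q n = (if n = 0 then 1 else 0)"
  shows "q (Suc n) \<le> 0"
proof (induction n rule: less_induct)
  case (less n)
  have conv_eq: "conv a q k = a k * q 0 + (\<Sum>i=1..k. a (k - i) * q i)" for k
  proof -
    have "conv a q k = (\<Sum>i=0..k. a (k - i) * q i)"
      unfolding conv_def
      by (rule sum.reindex_bij_witness[where i="\<lambda>j. k - j" and j="\<lambda>m. k - m"]) auto
    then show ?thesis by (simp add: sum.atLeast_Suc_atMost)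
  qed
  have q0: "q 0 > 0" using q[of 0] pos[of 0] by (simp add: conv_def zero_less_mult_iff)
      (metis less_numeral_extra(1) zero_less_mult_pos)
  show ?case
  proof (cases n)
    case 0
    have "a 1 * q 0 + a 0 * q 1 = 0" using q[of 1] conv_eq[of 1] by simp
    moreover have "a 1 * q 0 > 0" using pos q0 by simp
    ultimately have "a 0 * q 1 < 0" by linarith
    then show ?thesis using pos[of 0] 0 by (simp add: mult_less_0_iff)
  next
    case (Suc l)
    have e1: "a n * q 0 + (\<Sum>i=1..n. a (n - i) * q i) = 0"
      using q[of n] conv_eq[of n] Suc by simp
    have e2: "a (Suc n) * q 0 + (\<Sum>i=1..n. a (Suc n - i) * q i) + a 0 * q (Suc n) = 0"
      using q[of "Suc n"] conv_eq[of "Suc n"] by simp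
    have "a n * a 0 * q (Suc n) = a n * (- a (Suc n) * q 0 - (\<Sum>i=1..n. a (Suc n - i) * q i))"
      using e2 by (simp add: algebra_simps) algebra
    also have "\<dots> = a (Suc n) * (\<Sum>i=1..n. a (n - i) * q i) - a n * (\<Sum>i=1..n. a (Suc n - i) * q i)"
      using e1 by algebra
    also have "\<dots> = (\<Sum>i=1..n. (a (Suc n) * a (n - i) - a n * a (Suc n - i)) * q i)"
      by (simp add: sum_distrib_left sum_subtractf algebra_simps)
    also have "\<dots> \<le> 0"
    proof (intro sum_nonpos mult_nonneg_nonpos)
      fix i assume i: "i \<in> {1..n}"
      then have "Suc n - i = Suc (n - i)" by auto
      with log_convex_ratio_mono[of a "n - i" n, OF pos lc]
      show "0 \<le> a (Suc n) * a (n - i) - a n * a (Suc n - i)" by (simp add: mult.commute)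
      obtain j where "i = Suc j" "j < n" using i by (cases i) auto
      then show "q i \<le> 0" using less by simp
    qed
    finally show ?thesis using pos[of n] pos[of 0] by (simp add: mult_le_0_iff)
  qed
qed

section \<open>The implicit scheme\<close>

lemma all_ge_1_iff: "P 0 \<Longrightarrow> (\<forall>n\<ge>1. P n) \<longleftrightarrow> (\<forall>n. P n)" for P :: "nat \<Rightarrow> bool"
  by (metis One_nat_def Suc_leI gr0I)

lemma conv_coeff_a_inverse:
  assumes "0 < \<alpha>"
  shows "conv (coeff_a \<alpha>) (conv_inverse (coeff_a \<alpha>)) n = (if n = 0 then 1 else 0)"
  using conv_inverse_eq_fps(2)[of "coeff_a \<alpha>"] coeff_a_pos[OF assms, of 0] by (simp add: fun_eq_iff)

text \<open>The coefficient \<open>coeff_c_init\<close> is such that the operator annihilates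
  constants, so X 0 may be subtracted everywhere; the last term of the convolution then carries X 0
  - X 0 and drops out.\<close>

lemma discrete_caputo_eq_conv:
  assumes "1 \<le> n"
  shows "discrete_caputo \<alpha> k X n =
    k powr (- \<alpha>) * conv (conv_inverse (coeff_a \<alpha>)) (\<lambda>i. X i - X 0) n"
proof -
  let ?q = "conv_inverse (coeff_a \<alpha>)"
  have "{0..n} = insert 0 (insert n {1..<n})" using assms by auto
  then have "conv ?q (\<lambda>i. X i - X 0) n = ?q 0 * (X n - X 0) + (\<Sum>i=1..<n. ?q i * (X (n - i) - X 0))"
    using assms by (simp add: conv_def)
  also have "\<dots> = ?q 0 * X n + (\<Sum>i=1..<n. ?q i * X (n - i)) - (?q 0 + (\<Sum>i=1..<n. ?q i)) * X 0"
    by (simp add: algebra_simps sum_subtractf sum_distrib_left)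
  finally show ?thesis
    by (simp add: discrete_caputo_def coeff_c_init_def coeff_c_def sum_negf)
qed

lemma discrete_caputo_eq_iff_volterra:
  assumes "0 < \<alpha>" "0 < k"
  shows "(\<forall>n\<ge>1. discrete_caputo \<alpha> k X n = lam * X n) \<longleftrightarrow>
    (\<forall>n\<ge>1. X n = X 0 + lam * k powr \<alpha> * (\<Sum>m=1..n. coeff_a \<alpha> (n - m) * X m))"
proof -
  define h where "h = lam * k powr \<alpha>"
  define A where "A = Abs_fps (coeff_a \<alpha>)"
  define Q where "Q = Abs_fps (conv_inverse (coeff_a \<alpha>))"
  define Z where "Z = Abs_fps (\<lambda>i. X i - X 0)"
  \<comment> \<open>The Volterra sum starts at m = 1, so the value at 0 is erased. \<open>Z\<close>
    has constant term 0 as well; thus the coefficient at 0 is trivial in each series identity, and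
    equations for n \<ge> 1 become equalities of series, interchanged by multiplying with
    \<open>A\<close> or \<open>Q\<close>.\<close>
  define Y where "Y = Abs_fps (\<lambda>i. if i = 0 then 0 else X i)"
  have AQ: "A * Q = 1"
    using conv_coeff_a_inverse[OF assms(1)]
    by (auto simp: fps_eq_iff A_def Q_def conv_eq_fps_mult)
  have AY: "fps_nth (A * Y) n = (\<Sum>m=1..n. coeff_a \<alpha> (n - m) * X m)" for n
  proof -
    have "fps_nth (A * Y) n = (\<Sum>m=0..n. fps_nth A (n - m) * fps_nth Y m)"
      unfolding fps_mult_nth
      by (rule sum.reindex_bij_witness[where i="\<lambda>j. n - j" and j="\<lambda>m. n - m"]) auto
    also have "\<dots> = (\<Sum>m=1..n. coeff_a \<alpha> (n - m) * X m)"
      by (simp add: sum.atLeast_Suc_atMost[of 0] A_def Y_def)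
    finally show ?thesis .
  qed
  have "(\<forall>n\<ge>1. discrete_caputo \<alpha> k X n = lam * X n) \<longleftrightarrow> (\<forall>n\<ge>1. fps_nth (Q * Z) n = h * X n)"
    using assms(2)
    by (simp add: discrete_caputo_eq_conv conv_eq_fps_mult Q_def Z_def h_def powr_minus field_simps)
  also have "\<dots> \<longleftrightarrow> Q * Z = fps_const h * Y"
    by (auto simp: fps_eq_iff Y_def Z_def Suc_le_eq)
  also have "\<dots> \<longleftrightarrow> Z = fps_const h * (A * Y)"
  proof
    assume "Q * Z = fps_const h * Y"
    then have "A * (Q * Z) = fps_const h * (A * Y)" by (simp add: mult_ac)
    then show "Z = fps_const h * (A * Y)" using AQ by (simp add: mult.assoc[symmetric])
  next
    assume "Z = fps_const h * (A * Y)"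
    then have "Q * Z = (A * Q) * (fps_const h * Y)" by (simp add: mult_ac)
    then show "Q * Z = fps_const h * Y" using AQ by simp
  qed
  also have "\<dots> \<longleftrightarrow> (\<forall>n. X n - X 0 = h * (\<Sum>m=1..n. coeff_a \<alpha> (n - m) * X m))"
    by (simp add: fps_eq_iff AY) (simp add: Z_def)
  also have "\<dots> \<longleftrightarrow> (\<forall>n\<ge>1. X n = X 0 + h * (\<Sum>m=1..n. coeff_a \<alpha> (n - m) * X m))"
    by (subst all_ge_1_iff) (auto simp: diff_eq_eq add.commute)
  finally show ?thesis by (simp add: h_def)
qed

lemma implicit_schemeD:
  assumes "0 < \<alpha>" "0 < k" "implicit_scheme \<alpha> lam k x0 X"
  shows "X n = x0 + lam * k powr \<alpha> * (\<Sum>m=1..n. coeff_a \<alpha> (n - m) * X m)"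
  using assms(3) discrete_caputo_eq_iff_volterra[OF assms(1,2), of X lam]
  unfolding implicit_scheme_def by (cases "n = 0") auto

section \<open>Sign, monotonicity and long-time decay of the numerical solution\<close>

text \<open>Shifting the index turns the difference of two discrete integrals into the discrete
  integral of the increments plus a boundary term. For nonnegative data the boundary term is
  nonnegative, so the increments form a supersolution of the homogeneous equation.\<close>

lemma volterra_sum_Suc_diff:
  fixes a X :: "nat \<Rightarrow> real"
  shows "(\<Sum>m=1..Suc n. a (Suc n - m) * X m) - (\<Sum>m=1..n. a (n - m) * X m) =
     a n * X 1 + (\<Sum>m=1..n. a (n - m) * (X (Suc m) - X m))"
proof -
  have "(\<Sum>m=1..Suc n. a (Suc n - m) * X m) = a n * X 1 + (\<Sum>m=Suc 1..Suc n. a (Suc n - m) * X m)"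
    by (subst sum.atLeast_Suc_atMost) auto
  also have "(\<Sum>m=Suc 1..Suc n. a (Suc n - m) * X m) = (\<Sum>m=1..n. a (n - m) * X (Suc m))"
    by (subst sum.shift_bounds_cl_Suc_ivl) simp
  finally show ?thesis by (simp add: sum_subtractf algebra_simps)
qed

lemma discrete_volterra_nonneg:
  fixes a X :: "nat \<Rightarrow> real"
  assumes a: "\<And>j. 0 \<le> a j" and h: "0 \<le> h" "h * a 0 < 1" and "0 \<le> x0"
    and X: "\<And>n. X n = x0 + h * (\<Sum>m=1..n. a (n - m) * X m)"
  shows "0 \<le> X n"
proof (cases "n = 0")
  case True
  then show ?thesis using X[of 0] \<open>0 \<le> x0\<close> by simp
next
  case False
  have "- X i \<le> h * (\<Sum>m=1..i. a (i - m) * - X m)" for i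
    using X[of i] \<open>0 \<le> x0\<close> by (simp add: sum_negf)
  from discrete_comparison[where w="\<lambda>i. - X i" and N=n, OF a h this] False show ?thesis by auto
qed

lemma discrete_volterra_mono:
  fixes a X :: "nat \<Rightarrow> real"
  assumes a: "\<And>j. 0 \<le> a j" and h: "0 \<le> h" "h * a 0 < 1" and x0: "0 \<le> x0"
    and X: "\<And>n. X n = x0 + h * (\<Sum>m=1..n. a (n - m) * X m)"
  shows "X n \<le> X (Suc n)"
proof -
  note nonneg = discrete_volterra_nonneg[OF a h x0 X]
  have ge: "X (Suc i) - X i \<ge> h * (\<Sum>m=1..i. a (i - m) * (X (Suc m) - X m))" for i
  proof -
    have "X (Suc i) - X i = h * ((\<Sum>m=1..Suc i. a (Suc i - m) * X m) - (\<Sum>m=1..i. a (i - m) * X m))"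
      using X[of "Suc i"] X[of i] by (simp add: right_diff_distrib)
    moreover have "0 \<le> h * (a i * X 1)" using h a nonneg by simp
    ultimately show ?thesis unfolding volterra_sum_Suc_diff by (simp add: algebra_simps)
  qed
  show ?thesis
  proof (cases "n = 0")
    case True
    then show ?thesis using ge[of 0] by simp
  next
    case False
    have "X i - X (Suc i) \<le> h * (\<Sum>m=1..i. a (i - m) * (X m - X (Suc m)))" for i
      using ge[of i] by (simp add: sum_subtractf algebra_simps)
    from discrete_comparison[where w="\<lambda>i. X i - X (Suc i)" and N=n, OF a h this] False
    show ?thesis by auto
  qed
qed

text \<open>Solved for its leading term, the scheme writes \<open>(c 0 + h) * X n\<close> as a
  combination of earlier values. Subtracting the equations for n and n + 1 expresses the next
  decrement through earlier decrements with the weights \<open>c m \<ge> 0\<close>, so strong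
  induction applies.\<close>

lemma implicit_scheme_decreasing:
  assumes \<alpha>: "0 < \<alpha>" "\<alpha> < 1" and "0 < k" "lam < 0" and x0: "0 < x0"
    and X: "implicit_scheme \<alpha> lam k x0 X"
  shows "X (Suc n) \<le> X n"
proof -
  define h where "h = - lam * k powr \<alpha>"
  have h: "h > 0" using assms by (simp add: h_def mult_neg_pos)
  define c where "c = coeff_c \<alpha>"
  have c0: "c 0 > 0" using coeff_c_0[OF \<alpha>(1)] \<alpha> by (simp add: c_def)
  have c_nonneg: "0 \<le> c i" if "1 \<le> i" for i
    using kaluza[OF coeff_a_pos[OF \<alpha>(1)] coeff_a_log_convex[OF \<alpha>] conv_coeff_a_inverse[OF \<alpha>(1)], of "i - 1"]
      that by (simp add: c_def coeff_c_def)
  have eq: "(c 0 + h) * X i = (\<Sum>m=1..<i. c m * X (i - m)) + coeff_c_init \<alpha> i * X 0" if "1 \<le> i" for i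
  proof -
    have "discrete_caputo \<alpha> k X i = lam * X i" using X that by (simp add: implicit_scheme_def)
    then show ?thesis using \<open>0 < k\<close>
      by (simp add: discrete_caputo_def c_def h_def powr_minus field_simps)
  qed
  show ?thesis
  proof (induction n rule: less_induct)
    case (less n)
    have pos: "c 0 + h > 0" using c0 h by simp
    show ?case
    proof (cases "n = 0")
      case True
      have "(c 0 + h) * X 1 = c 0 * X 0" using eq[of 1] by (simp add: coeff_c_init_def c_def)
      also have "\<dots> \<le> (c 0 + h) * X 0" using X x0 h by (simp add: implicit_scheme_def distrib_right)
      finally show ?thesis using pos True by simp
    next
      case False
      \<comment> \<open>Passing from n to n + 1 takes the weight \<open>c n\<close> away from X 0
        and gives it to X 1, which produces the last term \<open>c n * (X 0 - X 1)\<close>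
        below.\<close>
      have init: "coeff_c_init \<alpha> (Suc n) = coeff_c_init \<alpha> n - c n"
        using False by (simp add: coeff_c_init_def c_def)
      have "(c 0 + h) * X (Suc n) = (\<Sum>m=1..<n. c m * X (Suc n - m)) + c n * X 1 + coeff_c_init \<alpha> (Suc n) * X 0"
        using eq[of "Suc n"] False by simp
      then have "(c 0 + h) * (X n - X (Suc n)) = (\<Sum>m=1..<n. c m * (X (n - m) - X (Suc n - m))) + c n * (X 0 - X 1)"
        using eq[of n] False init by (simp add: algebra_simps sum_subtractf)
      also have "\<dots> \<ge> 0"
      proof (intro add_nonneg_nonneg sum_nonneg mult_nonneg_nonneg)
        fix m assume m: "m \<in> {1..<n}"
        then show "0 \<le> c m" using c_nonneg by simp
        have "Suc n - m = Suc (n - m)" using m by auto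
        then show "0 \<le> X (n - m) - X (Suc n - m)" using less[of "n - m"] m by simp
      next
        show "0 \<le> c n" using c_nonneg False by simp
        show "0 \<le> X 0 - X 1" using less[of 0] False by simp
      qed
      finally show ?thesis using pos by (simp add: zero_le_mult_iff)
    qed
  qed
qed

text \<open>The Volterra sum enters with a minus sign, but subtracting the equation of the previous
  index replaces its weights by \<open>coeff_a \<alpha> j - coeff_a \<alpha> (Suc j) \<ge> 0\<close>
  with a plus sign, so nonnegativity is inherited from earlier values.\<close>

lemma implicit_scheme_nonneg_of_neg:
  assumes \<alpha>: "0 < \<alpha>" "\<alpha> < 1" and "0 < k" "lam < 0" and x0: "0 < x0"
    and X: "implicit_scheme \<alpha> lam k x0 X"
  shows "0 \<le> X n"
proof (induction n rule: less_induct)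
  case (less n)
  define h where "h = - lam * k powr \<alpha>"
  have h: "h > 0" using assms by (simp add: h_def mult_neg_pos)
  have V: "X i = x0 - h * (\<Sum>j<i. coeff_a \<alpha> j * X (i - j))" for i
    using implicit_schemeD[OF \<alpha>(1) \<open>0 < k\<close> X, of i] unfolding convolution_sum_flip h_def by linarith
  show ?case
  proof (cases n)
    case 0
    then show ?thesis using V[of 0] x0 by simp
  next
    case (Suc l)
    have "X n = X l - h * (coeff_a \<alpha> 0 * X n) + h * (\<Sum>j<l. (coeff_a \<alpha> j - coeff_a \<alpha> (Suc j)) * X (l - j))"
      using V[of n] V[of l] unfolding Suc sum.lessThan_Suc_shift
      by (simp add: algebra_simps sum_subtractf)
    then have "(1 + h * coeff_a \<alpha> 0) * X n = X l + h * (\<Sum>j<l. (coeff_a \<alpha> j - coeff_a \<alpha> (Suc j)) * X (l - j))"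
      by (simp add: algebra_simps)
    also have "\<dots> \<ge> 0"
      using less Suc h coeff_a_decreasing[OF \<alpha>]
      by (intro add_nonneg_nonneg mult_nonneg_nonneg sum_nonneg) auto
    finally show ?thesis
      using h coeff_a_pos[OF \<alpha>(1), of 0] by (simp add: zero_le_mult_iff add_pos_pos not_le)
        (smt (verit) mult_pos_pos)
  qed
qed

lemma implicit_scheme_tendsto_0:
  assumes \<alpha>: "0 < \<alpha>" "\<alpha> < 1" and "0 < k" "lam < 0" and x0: "0 < x0"
    and X: "implicit_scheme \<alpha> lam k x0 X"
  shows "X \<longlonglongrightarrow> 0"
proof -
  define h where "h = - lam * k powr \<alpha>"
  have h: "h > 0" using assms by (simp add: h_def mult_neg_pos)
  have G: "Gamma (1 + \<alpha>) > 0" using \<alpha> by (intro Gamma_real_pos) simp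
  have V: "X i = x0 - h * (\<Sum>j<i. coeff_a \<alpha> j * X (i - j))" for i
    using implicit_schemeD[OF \<alpha>(1) \<open>0 < k\<close> X, of i] unfolding convolution_sum_flip h_def by linarith
  have nonneg: "0 \<le> X i" for i by (rule implicit_scheme_nonneg_of_neg[OF assms])
  have dec: "decseq X" using implicit_scheme_decreasing[OF assms] by (simp add: decseq_Suc_iff)
  \<comment> \<open>An explicit decay rate: the partial sums of the weights telescope to a multiple
    of n^\<alpha>.\<close>
  have bound: "X n \<le> x0 * Gamma (1 + \<alpha>) / h * real n powr (- \<alpha>)" if "1 \<le> n" for n
  proof -
    have "h * (real n powr \<alpha> / Gamma (1 + \<alpha>) * X n) = h * (\<Sum>j<n. coeff_a \<alpha> j * X n)"
      by (simp add: sum_coeff_a[symmetric] sum_distrib_right)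
    also have "\<dots> \<le> h * (\<Sum>j<n. coeff_a \<alpha> j * X (n - j))"
      using h dec coeff_a_pos[OF \<alpha>(1)]
      by (intro mult_left_mono sum_mono) (auto simp: decseq_def less_imp_le)
    also have "\<dots> \<le> x0" using V[of n] nonneg[of n] by linarith
    finally show ?thesis using h G that by (simp add: powr_minus field_simps)
  qed
  have "(\<lambda>n. x0 * Gamma (1 + \<alpha>) / h * real n powr (- \<alpha>)) \<longlonglongrightarrow> x0 * Gamma (1 + \<alpha>) / h * 0"
    using \<alpha> by (intro tendsto_intros tendsto_neg_powr filterlim_real_sequentially) auto
  then have "(\<lambda>n. x0 * Gamma (1 + \<alpha>) / h * real n powr (- \<alpha>)) \<longlonglongrightarrow> 0" by simp
  from tendsto_sandwich[OF _ _ tendsto_const this, of X] show ?thesis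
    using nonneg bound by (auto simp: eventually_sequentially)
qed

section \<open>Step refinement and stability\<close>

text \<open>Homogeneity of the power function: a block of N consecutive weights telescopes to ((i +
  1) N)^\<alpha> - (i N)^\<alpha>. The factor N^\<alpha> is exactly the ratio of the k^\<alpha> for
  two steps k of ratio N, so coarse and fine sums agree at coarse nodes.\<close>

lemma coeff_a_block_sum:
  "(\<Sum>j=i*N..<i*N+N. coeff_a \<alpha> j) = real N powr \<alpha> * coeff_a \<alpha> i"
proof -
  have "(\<Sum>j=i*N..<i*N+N. coeff_a \<alpha> j) = (\<Sum>j<i*N+N. coeff_a \<alpha> j) - (\<Sum>j<i*N. coeff_a \<alpha> j)"
    by (simp add: lessThan_atLeast0 sum_diff_nat_ivl)
  also have "\<dots> = (real ((i + 1) * N) powr \<alpha> - real (i * N) powr \<alpha>) / Gamma (1 + \<alpha>)"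
    by (simp only: sum_coeff_a) (simp add: diff_divide_distrib algebra_simps)
  also have "\<dots> = real N powr \<alpha> * coeff_a \<alpha> i"
    by (simp only: of_nat_mult powr_mult coeff_a_def of_nat_add of_nat_1) (simp add: algebra_simps)
  finally show ?thesis .
qed

lemma convolution_sum_mono:
  fixes a Y :: "nat \<Rightarrow> real"
  assumes a: "\<And>j. 0 \<le> a j" and Y: "\<And>j. 0 \<le> Y j" "mono Y" and "m \<le> n"
  shows "(\<Sum>j<m. a j * Y (m - j)) \<le> (\<Sum>j<n. a j * Y (n - j))"
proof -
  have "(\<Sum>j<m. a j * Y (m - j)) \<le> (\<Sum>j<m. a j * Y (n - j))"
    using a \<open>m \<le> n\<close> by (intro sum_mono mult_left_mono monoD[OF Y(2)]) auto
  also have "\<dots> \<le> (\<Sum>j<n. a j * Y (n - j))"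
    using assms by (intro sum_mono2) auto
  finally show ?thesis .
qed

text \<open>The coarse solution, extended as a step function to the fine grid, is a supersolution of the
  fine scheme: the two discrete fractional integrals agree at the coarse nodes, and the fractional
  integral of a nonnegative nondecreasing function is nondecreasing.\<close>

lemma implicit_scheme_refine_le:
  assumes \<alpha>: "0 < \<alpha>" "\<alpha> < 1" and lam: "0 < lam" and k: "0 < k2" "k1 = real N * k2" and N: "0 < N"
    and small: "k1 powr \<alpha> * lam < coeff_c \<alpha> 0" "k2 powr \<alpha> * lam < coeff_c \<alpha> 0" and x0: "0 < x0"
    and X1: "implicit_scheme \<alpha> lam k1 x0 X1" and X2: "implicit_scheme \<alpha> lam k2 x0 X2"
    and n: "1 \<le> n" "(n - 1) * N < m" "m \<le> n * N"
  shows "X2 m \<le> X1 n"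
proof -
  have k1: "0 < k1" using k N by simp
  have G: "Gamma (1 + \<alpha>) > 0" using \<alpha> by (intro Gamma_real_pos) simp
  define h1 h2 where "h1 = lam * k1 powr \<alpha>" and "h2 = lam * k2 powr \<alpha>"
  have a: "0 \<le> coeff_a \<alpha> j" for j using coeff_a_pos[OF \<alpha>(1), of j] by simp
  have h: "0 \<le> h1" "h1 * coeff_a \<alpha> 0 < 1" "0 \<le> h2" "h2 * coeff_a \<alpha> 0 < 1"
    using lam small G by (simp_all add: h1_def h2_def coeff_a_0 coeff_c_0[OF \<alpha>(1)] mult.commute)
  have h12: "h1 = h2 * real N powr \<alpha>"
    using k N by (simp add: h1_def h2_def powr_mult)
  have V1: "X1 i = x0 + h1 * (\<Sum>m=1..i. coeff_a \<alpha> (i - m) * X1 m)" for i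
    using implicit_schemeD[OF \<alpha>(1) k1 X1, of i] by (simp add: h1_def)
  have V2: "X2 i = x0 + h2 * (\<Sum>m=1..i. coeff_a \<alpha> (i - m) * X2 m)" for i
    using implicit_schemeD[OF \<alpha>(1) k(1) X2, of i] by (simp add: h2_def)
  have X1_nonneg: "0 \<le> X1 i" for i
    using discrete_volterra_nonneg[OF a h(1,2) _ V1] x0 by simp
  have X1_mono: "mono X1"
    using discrete_volterra_mono[OF a h(1,2) _ V1] x0 by (simp add: mono_iff_le_Suc)
  \<comment> \<open>The quotient is i / N rounded up, so that all fine indices in the half-open cell
    from (l - 1) N, excluded, to l N, included, receive the value \<open>X1 l\<close>.\<close>
  define Y where "Y i = X1 ((i + (N - 1)) div N)" for i
  have Y_eq: "Y i = X1 l" if "i = l * N - r" "r < N" "1 \<le> l" for i l r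
  proof -
    have "N \<le> l * N" using that by (cases l) auto
    then have "i + (N - 1) = l * N + (N - 1 - r)" using that by linarith
    moreover have "(l * N + (N - 1 - r)) div N = l" using N by simp
    ultimately show ?thesis by (simp add: Y_def)
  qed
  have Y_mono: "mono Y"
    unfolding Y_def by (intro monoI monoD[OF X1_mono] div_le_mono) simp
  have Y_nonneg: "0 \<le> Y i" for i by (simp add: Y_def X1_nonneg)
  have block: "(\<Sum>j<l*N. coeff_a \<alpha> j * Y (l * N - j)) = real N powr \<alpha> * (\<Sum>i<l. coeff_a \<alpha> i * X1 (l - i))" for l
  proof -
    have "(\<Sum>j<l*N. coeff_a \<alpha> j * Y (l * N - j)) = (\<Sum>i<l. \<Sum>j=i*N..<i*N+N. coeff_a \<alpha> j * Y (l * N - j))"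
      by (simp add: sum.nat_group)
    also have "\<dots> = (\<Sum>i<l. \<Sum>j=i*N..<i*N+N. coeff_a \<alpha> j * X1 (l - i))"
    proof (intro sum.cong refl)
      fix i j assume ij: "i \<in> {..<l}" "j \<in> {i*N..<i*N+N}"
      have "Y (l * N - j) = X1 (l - i)"
        using ij by (intro Y_eq[where r="j - i * N"]) (auto simp: algebra_simps)
      then show "coeff_a \<alpha> j * Y (l * N - j) = coeff_a \<alpha> j * X1 (l - i)" by simp
    qed
    also have "\<dots> = (\<Sum>i<l. real N powr \<alpha> * coeff_a \<alpha> i * X1 (l - i))"
      by (simp only: sum_distrib_right[symmetric] coeff_a_block_sum)
    finally show ?thesis by (simp add: sum_distrib_left mult.assoc)
  qed
  have super: "Y i \<ge> x0 + h2 * (\<Sum>m=1..i. coeff_a \<alpha> (i - m) * Y m)" if "1 \<le> i" for i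
  proof -
    define l where "l = (i + (N - 1)) div N"
    have "i + (N - 1) = l * N + (i + (N - 1)) mod N" by (simp add: l_def)
    moreover have "(i + (N - 1)) mod N < N" using N by simp
    ultimately have "i \<le> l * N" by linarith
    have "x0 + h2 * (\<Sum>m=1..i. coeff_a \<alpha> (i - m) * Y m) \<le> x0 + h2 * (\<Sum>j<l*N. coeff_a \<alpha> j * Y (l * N - j))"
      unfolding convolution_sum_flip using h \<open>i \<le> l * N\<close>
      by (intro add_left_mono mult_left_mono convolution_sum_mono a Y_nonneg Y_mono) auto
    also have "\<dots> = X1 l" unfolding block V1[of l] convolution_sum_flip by (simp add: h12)
    finally show ?thesis by (simp add: Y_def l_def)
  qed
  have "X2 i - Y i \<le> h2 * (\<Sum>m=1..i. coeff_a \<alpha> (i - m) * (X2 m - Y m))" if "1 \<le> i" for i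
    using super[OF that] V2[of i] by (simp add: sum_subtractf right_diff_distrib)
  from discrete_comparison[where w="\<lambda>i. X2 i - Y i" and N=m, OF a h(3,4) this, of m]
  have "X2 m \<le> Y m" using n by auto
  also have "Y m = X1 n"
  proof (rule Y_eq[where r="n * N - m"])
    obtain p where "n = Suc p" using n by (cases n) auto
    then show "n * N - m < N" using n by auto
  qed (use n in auto)
  finally show ?thesis .
qed

lemma pw_const_step:
  assumes "0 < k" "0 < t"
  obtains n where "1 \<le> n" "(real n - 1) * k < t" "t \<le> real n * k" "\<And>X. pw_const k X t = X n"
proof -
  define n where "n = nat \<lceil>t / k\<rceil>"
  have tk: "0 < t / k" using assms by simp
  then have pos: "0 < \<lceil>t / k\<rceil>" by simp
  then have n: "real n = of_int \<lceil>t / k\<rceil>" by (simp add: n_def)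
  have "1 \<le> n" using pos unfolding n_def by linarith
  moreover have "real n - 1 < t / k" "t / k \<le> real n" unfolding n by linarith+
  then have "(real n - 1) * k < t" "t \<le> real n * k" using assms by (simp_all add: field_simps)
  moreover from calculation have "pw_const k X t = X n" for X
    using assms by (intro pw_const_eq) auto
  ultimately show ?thesis using that by blast
qed

text \<open>If t lies in the n-th coarse and the m-th fine cell, the half-open shape of the cells
  forces (n - 1) N < m \<le> n N, which is the index range of
  \<open>implicit_scheme_refine_le\<close>.\<close>

lemma pw_const_refine_le:
  assumes \<alpha>: "0 < \<alpha>" "\<alpha> < 1" and lam: "0 < lam" and k: "0 < k2" "k1 = real N * k2" and N: "0 < N"
    and small: "k1 powr \<alpha> * lam < coeff_c \<alpha> 0" "k2 powr \<alpha> * lam < coeff_c \<alpha> 0" and x0: "0 < x0"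
    and X1: "implicit_scheme \<alpha> lam k1 x0 X1" and X2: "implicit_scheme \<alpha> lam k2 x0 X2"
    and "0 < t"
  shows "pw_const k2 X2 t \<le> pw_const k1 X1 t"
proof -
  have k1: "0 < k1" using k N by simp
  obtain n where n: "1 \<le> n" "(real n - 1) * k1 < t" "t \<le> real n * k1" "pw_const k1 X1 t = X1 n"
    using pw_const_step[OF k1 \<open>0 < t\<close>] by metis
  obtain m where m: "1 \<le> m" "(real m - 1) * k2 < t" "t \<le> real m * k2" "pw_const k2 X2 t = X2 m"
    using pw_const_step[OF k(1) \<open>0 < t\<close>] by metis
  have "((real n - 1) * real N) * k2 < real m * k2" using n(2) m(3) unfolding k(2) mult.assoc by linarith
  then have "(real n - 1) * real N < real m" using k(1) by (simp only: mult_less_cancel_right_pos)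
  then have "real ((n - 1) * N) < real m" using n(1) by (simp add: of_nat_diff)
  then have 1: "(n - 1) * N < m" by (simp only: of_nat_less_iff)
  have "(real m - 1) * k2 < (real n * real N) * k2" using n(3) m(2) unfolding k(2) mult.assoc by linarith
  then have "real m - 1 < real n * real N" using k(1) by (simp only: mult_less_cancel_right_pos)
  then have "real m < real (n * N + 1)" by simp
  then have "m \<le> n * N" by (simp only: of_nat_less_iff)
  with 1 n m show ?thesis
    using implicit_scheme_refine_le[OF \<alpha> lam k N small x0 X1 X2 n(1), of m] by simp
qed

text \<open>A discrete Gronwall inequality for the weakly singular kernel, obtained by comparison with the
  supersolution \<open>4 R exp (\<mu> t\<^sub>n)\<close>: the part of the kernel on a fixed time interval of length at most
  \<open>K\<close> contributes at most \<open>1 / 2\<close>, and the rest is damped by choosing \<open>\<mu>\<close> large.\<close>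

lemma discrete_gronwall:
  assumes \<alpha>: "0 < \<alpha>" "\<alpha> < 1" and lam: "0 < lam" and T: "0 < T"
  obtains C where "1 \<le> C"
    "\<forall>k R u n N. 0 < k \<longrightarrow> k powr \<alpha> * lam \<le> 1 / 2 * coeff_c \<alpha> 0 \<longrightarrow> 0 \<le> R \<longrightarrow> real N * k \<le> T \<longrightarrow>
       1 \<le> n \<longrightarrow> n \<le> N \<longrightarrow>
       (\<forall>i. 1 \<le> i \<longrightarrow> i \<le> N \<longrightarrow> u i \<le> R + lam * k powr \<alpha> * (\<Sum>m=1..i. coeff_a \<alpha> (i - m) * u m)) \<longrightarrow>
       u n \<le> C * R"
proof -
  define G where "G = Gamma (1 + \<alpha>)"
  have G: "G > 0" using \<alpha> unfolding G_def by (intro Gamma_real_pos) simp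
  have c0: "coeff_c \<alpha> 0 = G" using coeff_c_0[OF \<alpha>(1)] by (simp add: G_def)
  have a: "0 \<le> coeff_a \<alpha> j" for j using coeff_a_pos[OF \<alpha>(1), of j] by simp
  \<comment> \<open>Solves lam K^\<alpha> / Gamma (1 + \<alpha>) = 1/2: the kernel mass over a time
    K is one half, and the smallness condition on the step is precisely k \<le> K.\<close>
  define K where "K = (G / (2 * lam)) powr (1 / \<alpha>)"
  have K: "0 < K" using G lam by (simp add: K_def)
  have K_powr: "K powr \<alpha> = G / (2 * lam)" using G lam \<alpha> by (simp add: K_def powr_powr)
  define B where "B = lam * T powr \<alpha> / G"
  have B: "0 \<le> B" using lam G by (simp add: B_def)
  \<comment> \<open>\<open>B\<close> bounds the kernel mass up to time T. The choice gives exp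
    (-\<mu> K / 2) = 1 / (4 B + 1), so the damped far part contributes at most B / (4 B + 1) \<le>
    1/4.\<close>
  define \<mu> where "\<mu> = 2 / K * ln (4 * B + 1)"
  have \<mu>: "0 \<le> \<mu>" using K B by (simp add: \<mu>_def)
  define C where "C = 4 * exp (\<mu> * T)"
  show ?thesis
  proof
    show "1 \<le> C" unfolding C_def using one_le_exp_iff[of "\<mu> * T"] mult_nonneg_nonneg[of \<mu> T] \<mu> T by linarith
  next
    show "\<forall>k R u n N. 0 < k \<longrightarrow> k powr \<alpha> * lam \<le> 1 / 2 * coeff_c \<alpha> 0 \<longrightarrow> 0 \<le> R \<longrightarrow> real N * k \<le> T \<longrightarrow>
       1 \<le> n \<longrightarrow> n \<le> N \<longrightarrow>
       (\<forall>i. 1 \<le> i \<longrightarrow> i \<le> N \<longrightarrow> u i \<le> R + lam * k powr \<alpha> * (\<Sum>m=1..i. coeff_a \<alpha> (i - m) * u m)) \<longrightarrow>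
       u n \<le> C * R"
    proof (intro allI impI)
      fix k R :: real and u n N
      assume k: "0 < k" and small: "k powr \<alpha> * lam \<le> 1 / 2 * coeff_c \<alpha> 0" and R: "0 \<le> R"
        and N: "real N * k \<le> T" and n: "1 \<le> n" "n \<le> N"
        and u: "\<forall>i. 1 \<le> i \<longrightarrow> i \<le> N \<longrightarrow> u i \<le> R + lam * k powr \<alpha> * (\<Sum>m=1..i. coeff_a \<alpha> (i - m) * u m)"
      define h where "h = lam * k powr \<alpha>"
      have h0: "0 \<le> h" using lam by (simp add: h_def)
      have ha: "h * coeff_a \<alpha> 0 < 1"
        using small G c0 by (simp add: h_def coeff_a_0 G_def[symmetric] field_simps)
      have "k powr \<alpha> \<le> K powr \<alpha>" using small lam c0 by (simp add: K_powr field_simps)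
      then have kK: "k \<le> K" using k K \<alpha> by (meson not_le powr_less_mono2 less_imp_le)
      \<comment> \<open>The number of whole steps in K. It is at least 1, so K < J k + k \<le> 2 J
        k: the near part still covers half of K, whatever the step.\<close>
      define J where "J = nat \<lfloor>K / k\<rfloor>"
      have "1 \<le> K / k" using kK k by simp
      then have "1 \<le> \<lfloor>K / k\<rfloor>" by simp
      then have "real J = of_int \<lfloor>K / k\<rfloor>" "1 \<le> real_of_int \<lfloor>K / k\<rfloor>" by (simp_all add: J_def)
      then have J1: "1 \<le> real J" "real J \<le> K / k" "K / k < real J + 1" by linarith+
      then have J2: "real J * k \<le> K" "K < real J * k + k" using k by (simp_all add: field_simps)
      have "k \<le> real J * k" using J1 k by simp
      with J2 have J3: "K / 2 \<le> real J * k" by linarith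
      \<comment> \<open>The factor 4 makes R \<le> v / 4, which fills the gap left by the kernel
        contribution of at most 3/4 v.\<close>
      define v where "v i = 4 * R * exp (\<mu> * (real i * k))" for i
      have hsum: "h * (\<Sum>j<i. coeff_a \<alpha> j) = lam * (real i * k) powr \<alpha> / G" for i
        using k by (simp add: sum_coeff_a h_def G_def powr_mult)
      have near: "h * (\<Sum>j<J. coeff_a \<alpha> j) \<le> 1 / 2"
      proof -
        have "(real J * k) powr \<alpha> \<le> K powr \<alpha>" using J2 k \<alpha> by (intro powr_mono2) auto
        then show ?thesis unfolding hsum K_powr using lam G by (simp add: field_simps)
      qed
      have damp: "exp (- \<mu> * (real J * k)) \<le> 1 / (4 * B + 1)"
      proof -
        have "ln (4 * B + 1) = \<mu> * (K / 2)" using K by (simp add: \<mu>_def)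
        also have "\<dots> \<le> \<mu> * (real J * k)" using \<mu> J3 by (intro mult_left_mono) auto
        finally have "exp (- \<mu> * (real J * k)) \<le> exp (- ln (4 * B + 1))" by simp
        also have "\<dots> = 1 / (4 * B + 1)" using B by (simp add: exp_minus field_simps)
        finally show ?thesis .
      qed
      have super: "R + h * (\<Sum>m=1..i. coeff_a \<alpha> (i - m) * v m) \<le> v i" if i: "1 \<le> i" "i \<le> N" for i
      proof -
        have iT: "real i * k \<le> T" using i k N by (meson mult_right_mono of_nat_le_iff order_trans less_imp_le)
        have far: "h * (\<Sum>j<i. coeff_a \<alpha> j) \<le> B"
        proof -
          have "(real i * k) powr \<alpha> \<le> T powr \<alpha>" using iT k \<alpha> by (intro powr_mono2) auto
          then show ?thesis unfolding hsum B_def using lam G by (simp add: divide_right_mono)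
        qed
        \<comment> \<open>The exponential is estimated by 1 for lags j < J and by its value at J for
          the others.\<close>
        have "(\<Sum>j<i. coeff_a \<alpha> j * exp (- \<mu> * (real j * k))) \<le>
            (\<Sum>j<i. (if j < J then coeff_a \<alpha> j else 0) + coeff_a \<alpha> j * exp (- \<mu> * (real J * k)))"
        proof (rule sum_mono)
          fix j
          show "coeff_a \<alpha> j * exp (- \<mu> * (real j * k)) \<le>
            (if j < J then coeff_a \<alpha> j else 0) + coeff_a \<alpha> j * exp (- \<mu> * (real J * k))"
          proof (cases "j < J")
            case True
            have "coeff_a \<alpha> j * exp (- \<mu> * (real j * k)) \<le> coeff_a \<alpha> j * 1"
              using \<mu> k by (intro mult_left_mono a) simp
            moreover have "0 \<le> coeff_a \<alpha> j * exp (- \<mu> * (real J * k))" using a[of j] by simp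
            ultimately show ?thesis using True by simp
          next
            case False
            then have "\<mu> * (real J * k) \<le> \<mu> * (real j * k)"
              using \<mu> k by (intro mult_left_mono mult_right_mono) auto
            then have "coeff_a \<alpha> j * exp (- \<mu> * (real j * k)) \<le> coeff_a \<alpha> j * exp (- \<mu> * (real J * k))"
              by (intro mult_left_mono a) simp
            then show ?thesis using False by simp
          qed
        qed
        also have "\<dots> = (\<Sum>j\<in>{..<i} \<inter> {..<J}. coeff_a \<alpha> j) + (\<Sum>j<i. coeff_a \<alpha> j) * exp (- \<mu> * (real J * k))"
          by (simp add: sum.distrib sum_distrib_right sum.If_cases lessThan_def)
        also have "\<dots> \<le> (\<Sum>j<J. coeff_a \<alpha> j) + (\<Sum>j<i. coeff_a \<alpha> j) * (1 / (4 * B + 1))"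
          by (intro add_mono sum_mono2 mult_left_mono damp sum_nonneg a) auto
        finally have "h * (\<Sum>j<i. coeff_a \<alpha> j * exp (- \<mu> * (real j * k)))
            \<le> h * ((\<Sum>j<J. coeff_a \<alpha> j) + (\<Sum>j<i. coeff_a \<alpha> j) * (1 / (4 * B + 1)))"
          using h0 by (intro mult_left_mono)
        also have "\<dots> = h * (\<Sum>j<J. coeff_a \<alpha> j) + h * (\<Sum>j<i. coeff_a \<alpha> j) * (1 / (4 * B + 1))"
          by (simp only: distrib_left mult.assoc)
        also have "\<dots> \<le> 1 / 2 + B * (1 / (4 * B + 1))"
          using B by (intro add_mono near mult_right_mono far) auto
        also have "B * (1 / (4 * B + 1)) \<le> 1 / 4" using B by (simp add: field_simps)
        finally have kern: "h * (\<Sum>j<i. coeff_a \<alpha> j * exp (- \<mu> * (real j * k))) \<le> 3 / 4" by simp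
        have "(\<Sum>m=1..i. coeff_a \<alpha> (i - m) * v m) = v i * (\<Sum>j<i. coeff_a \<alpha> j * exp (- \<mu> * (real j * k)))"
          unfolding convolution_sum_flip sum_distrib_left
        proof (intro sum.cong refl)
          fix j assume "j \<in> {..<i}"
          then have "\<mu> * (real (i - j) * k) = \<mu> * (real i * k) + - \<mu> * (real j * k)"
            by (simp add: of_nat_diff algebra_simps)
          then have "exp (\<mu> * (real (i - j) * k)) = exp (\<mu> * (real i * k)) * exp (- \<mu> * (real j * k))"
            by (simp only: exp_add)
          then show "coeff_a \<alpha> j * v (i - j) = v i * (coeff_a \<alpha> j * exp (- \<mu> * (real j * k)))"
            by (simp add: v_def)
        qed
        then have "h * (\<Sum>m=1..i. coeff_a \<alpha> (i - m) * v m) = v i * (h * (\<Sum>j<i. coeff_a \<alpha> j * exp (- \<mu> * (real j * k))))"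
          by simp
        also have "\<dots> \<le> v i * (3 / 4)" using R by (intro mult_left_mono kern) (simp add: v_def)
        finally have "h * (\<Sum>m=1..i. coeff_a \<alpha> (i - m) * v m) \<le> v i * (3 / 4)" .
        moreover have "R * 1 \<le> R * exp (\<mu> * (real i * k))" using R \<mu> k by (intro mult_left_mono) auto
        ultimately show ?thesis by (simp add: v_def)
      qed
      have "u i - v i \<le> h * (\<Sum>m=1..i. coeff_a \<alpha> (i - m) * (u m - v m))" if "1 \<le> i" "i \<le> N" for i
        using super[OF that] u[rule_format, OF that] by (simp add: h_def sum_subtractf right_diff_distrib)
      from discrete_comparison[where w="\<lambda>i. u i - v i", OF a h0 ha this n] have "u n \<le> v n" by simp
      also have "\<dots> \<le> C * R"
      proof -
        have "real n * k \<le> T" using n k N by (meson mult_right_mono of_nat_le_iff order_trans less_imp_le)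
        then have "exp (\<mu> * (real n * k)) \<le> exp (\<mu> * T)" using \<mu> by (simp add: mult_left_mono)
        then show ?thesis using R by (simp add: v_def C_def mult.commute mult_left_mono)
      qed
      finally show "u n \<le> C * R" .
    qed
  qed
qed

text \<open>Gronwall with forcing R = X 0; its constant is fixed before the step and the solution
  are chosen. The index set is finite and contains 0, so the supremum is a genuine maximum.\<close>

lemma implicit_scheme_bound:
  assumes \<alpha>: "0 < \<alpha>" "\<alpha> < 1" and lam: "0 < lam" and T: "0 < T"
  shows "\<exists>C>0. \<forall>x0>0. \<forall>k>0. \<forall>X. k powr \<alpha> * lam \<le> 1 / 2 * coeff_c \<alpha> 0 \<longrightarrow>
    implicit_scheme \<alpha> lam k x0 X \<longrightarrow> (SUP n\<in>{n. real n * k \<le> T}. X n) \<le> C * X 0"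
proof -
  obtain C where C: "1 \<le> C"
    "\<forall>k R u n N. 0 < k \<longrightarrow> k powr \<alpha> * lam \<le> 1 / 2 * coeff_c \<alpha> 0 \<longrightarrow> 0 \<le> R \<longrightarrow> real N * k \<le> T \<longrightarrow>
       1 \<le> n \<longrightarrow> n \<le> N \<longrightarrow>
       (\<forall>i. 1 \<le> i \<longrightarrow> i \<le> N \<longrightarrow> u i \<le> R + lam * k powr \<alpha> * (\<Sum>m=1..i. coeff_a \<alpha> (i - m) * u m)) \<longrightarrow>
       u n \<le> C * R"
    by (rule discrete_gronwall[OF assms]) (rule that)
  have "(SUP n\<in>{n. real n * k \<le> T}. X n) \<le> C * X 0"
    if x0: "0 < x0" and k: "0 < k" "k powr \<alpha> * lam \<le> 1 / 2 * coeff_c \<alpha> 0"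
      and X: "implicit_scheme \<alpha> lam k x0 X" for x0 k X
  proof (rule cSUP_least)
    show "{n. real n * k \<le> T} \<noteq> {}" using T by (auto intro!: exI[of _ 0])
    fix n assume n: "n \<in> {n. real n * k \<le> T}"
    have X0: "X 0 = x0" using X by (simp add: implicit_scheme_def)
    show "X n \<le> C * X 0"
    proof (cases "n = 0")
      case True
      then show ?thesis using C(1) x0 X0 by simp
    next
      case False
      show ?thesis
      proof (rule C(2)[rule_format, where N=n])
        show "X i \<le> X 0 + lam * k powr \<alpha> * (\<Sum>m=1..i. coeff_a \<alpha> (i - m) * X m)" for i
          using implicit_schemeD[OF \<alpha>(1) k(1) X, of i] X0 by simp
      qed (use k n False x0 X0 in auto)
    qed
  qed
  with C(1) show ?thesis by (intro exI[of _ C]) auto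
qed

section \<open>The Mittag-Leffler function and the Caputo derivative\<close>

text \<open>With p = x + \<alpha>, the point x + 1 is the convex combination \<alpha> p + (1 -
  \<alpha>) (p + 1), so log-convexity of Gamma bounds Gamma (x + 1) by p^(1 - \<alpha>) Gamma p. The
  resulting bound tends to 0 as x grows, which is what the ratio test for the Mittag-Leffler series
  needs.\<close>

lemma Gamma_ratio_bound:
  fixes x \<alpha> :: real
  assumes "0 < x" "0 < \<alpha>" "\<alpha> < 1"
  shows "Gamma x / Gamma (x + \<alpha>) \<le> (x + \<alpha>) powr (1 - \<alpha>) / x"
proof -
  define p where "p = x + \<alpha>"
  have p: "0 < p" using assms by (simp add: p_def)
  have Gx: "Gamma (x + 1) = x * Gamma x" "Gamma (p + 1) = p * Gamma p"
    using assms p by (simp_all add: Gamma_plus1 nonpos_Ints_def)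
  have pos: "0 < Gamma x" "0 < Gamma p" using assms p by auto
  have "(ln \<circ> Gamma) ((1 - (1 - \<alpha>)) *\<^sub>R p + (1 - \<alpha>) *\<^sub>R (p + 1))
     \<le> (1 - (1 - \<alpha>)) * (ln \<circ> Gamma) p + (1 - \<alpha>) * (ln \<circ> Gamma) (p + 1)"
    using assms p by (intro convex_onD[OF log_convex_Gamma_real]) auto
  also have "(1 - (1 - \<alpha>)) *\<^sub>R p + (1 - \<alpha>) *\<^sub>R (p + 1) = x + 1" by (simp add: p_def algebra_simps)
  finally have "ln (x * Gamma x) \<le> \<alpha> * ln (Gamma p) + (1 - \<alpha>) * ln (p * Gamma p)"
    by (simp add: Gx)
  also have "\<dots> = ln (p powr (1 - \<alpha>) * Gamma p)"
    using p pos by (simp add: ln_mult ln_powr algebra_simps)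
  finally have "x * Gamma x \<le> p powr (1 - \<alpha>) * Gamma p"
    using p pos assms by (subst (asm) ln_le_cancel_iff) auto
  then show ?thesis using pos assms unfolding p_def[symmetric] by (simp add: field_simps)
qed

lemma mittag_leffler_summable:
  fixes z \<alpha> :: real
  assumes "0 < \<alpha>" "\<alpha> < 1"
  shows "summable (\<lambda>n. 1 / Gamma (real n * \<alpha> + 1) * z ^ n)"
proof -
  have "((\<lambda>x. (x + \<alpha>) powr (1 - \<alpha>) / x) \<longlongrightarrow> 0) at_top" using assms by real_asymp
  moreover have "filterlim (\<lambda>n. real n * \<alpha> + 1) at_top sequentially" using assms by real_asymp
  ultimately have "(\<lambda>n. (real n * \<alpha> + 1 + \<alpha>) powr (1 - \<alpha>) / (real n * \<alpha> + 1)) \<longlonglongrightarrow> 0"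
    by (rule filterlim_compose)
  then have "(\<lambda>n. \<bar>z\<bar> * ((real n * \<alpha> + 1 + \<alpha>) powr (1 - \<alpha>) / (real n * \<alpha> + 1))) \<longlonglongrightarrow> \<bar>z\<bar> * 0"
    by (intro tendsto_intros)
  then have "\<forall>\<^sub>F n in sequentially. \<bar>z\<bar> * ((real n * \<alpha> + 1 + \<alpha>) powr (1 - \<alpha>) / (real n * \<alpha> + 1)) < 1 / 2"
    by (rule order_tendstoD) simp
  then obtain N where N: "\<And>n. N \<le> n \<Longrightarrow>
      \<bar>z\<bar> * ((real n * \<alpha> + 1 + \<alpha>) powr (1 - \<alpha>) / (real n * \<alpha> + 1)) < 1 / 2"
    by (auto simp: eventually_sequentially)
  show ?thesis
  proof (rule summable_ratio_test[of "1 / 2" N])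
    fix n assume "N \<le> n"
    define x where "x = real n * \<alpha> + 1"
    have x: "0 < x" using assms by (simp add: x_def add_nonneg_pos)
    have G: "0 < Gamma x" "0 < Gamma (x + \<alpha>)" using x assms by auto
    have "\<bar>z\<bar> * (Gamma x / Gamma (x + \<alpha>)) \<le> \<bar>z\<bar> * ((x + \<alpha>) powr (1 - \<alpha>) / x)"
      by (intro mult_left_mono Gamma_ratio_bound x assms) simp
    also have "\<dots> \<le> 1 / 2" using N[OF \<open>N \<le> n\<close>] by (simp add: x_def)
    finally have *: "\<bar>z\<bar> * (Gamma x / Gamma (x + \<alpha>)) \<le> 1 / 2" .
    have "norm (1 / Gamma (real (Suc n) * \<alpha> + 1) * z ^ Suc n) = \<bar>z\<bar> * \<bar>z\<bar> ^ n / Gamma (x + \<alpha>)"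
      using G by (simp add: x_def abs_mult power_abs algebra_simps)
    also have "\<dots> = (\<bar>z\<bar> * (Gamma x / Gamma (x + \<alpha>))) * (\<bar>z\<bar> ^ n / Gamma x)"
      using G by simp
    also have "\<dots> \<le> 1 / 2 * (\<bar>z\<bar> ^ n / Gamma x)"
      using G by (intro mult_right_mono *) simp
    also have "\<dots> = 1 / 2 * norm (1 / Gamma (real n * \<alpha> + 1) * z ^ n)"
      using G by (simp add: x_def abs_mult power_abs)
    finally show "norm (1 / Gamma (real (Suc n) * \<alpha> + 1) * z ^ Suc n) \<le>
        1 / 2 * norm (1 / Gamma (real n * \<alpha> + 1) * z ^ n)" .
  qed simp
qed

text \<open>This is 1 / \<alpha> times the two-parameter Mittag-Leffler function with both
  parameters \<alpha>; \<open>diffs\<close> matches the form of termwise differentiation.\<close>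

definition mittag_leffler_deriv :: "real \<Rightarrow> real \<Rightarrow> real" where
  "mittag_leffler_deriv \<alpha> z = (\<Sum>n. diffs (\<lambda>n. 1 / Gamma (real n * \<alpha> + 1)) n * z ^ n)"

lemma mittag_leffler_eq: "mittag_leffler \<alpha> z = (\<Sum>n. 1 / Gamma (real n * \<alpha> + 1) * z ^ n)"
  by (simp add: mittag_leffler_def)

lemma mittag_leffler_has_derivative:
  assumes "0 < \<alpha>" "\<alpha> < 1"
  shows "(mittag_leffler \<alpha> has_real_derivative mittag_leffler_deriv \<alpha> z) (at z)"
  unfolding mittag_leffler_deriv_def mittag_leffler_eq[abs_def]
  by (rule termdiffs_strong_converges_everywhere) (rule mittag_leffler_summable[OF assms])

lemma mittag_leffler_deriv_sums:
  assumes "0 < \<alpha>" "\<alpha> < 1"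
  shows "(\<lambda>n. z ^ n / (\<alpha> * Gamma (real (Suc n) * \<alpha>))) sums mittag_leffler_deriv \<alpha> z"
proof -
  have "diffs (\<lambda>n. 1 / Gamma (real n * \<alpha> + 1)) n * z ^ n = z ^ n / (\<alpha> * Gamma (real (Suc n) * \<alpha>))" for n
  proof -
    have "real (Suc n) * \<alpha> > 0" using assms by simp
    then have "Gamma (real (Suc n) * \<alpha> + 1) = real (Suc n) * \<alpha> * Gamma (real (Suc n) * \<alpha>)"
      by (subst Gamma_plus1) (auto elim!: nonpos_Ints_cases)
    then show ?thesis using assms by (simp add: diffs_def)
  qed
  moreover have "summable (\<lambda>n. diffs (\<lambda>n. 1 / Gamma (real n * \<alpha> + 1)) n * z ^ n)"
    by (rule termdiff_converges_all) (rule mittag_leffler_summable[OF assms])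
  ultimately show ?thesis
    unfolding mittag_leffler_deriv_def by (simp add: summable_sums)
qed

lemma has_integral_Beta_interval:
  fixes a b s t :: real
  assumes "0 < a" "0 < b" "s < t"
  shows "((\<lambda>u. (t - u) powr (a - 1) * (u - s) powr (b - 1)) has_integral
    Beta a b * (t - s) powr (a + b - 1)) {s..t}"
proof -
  define d where "d = t - s"
  have d: "0 < d" using assms by (simp add: d_def)
  have "((\<lambda>x. x powr (b - 1) * (1 - x) powr (a - 1)) has_integral Beta b a) (cbox 0 1)"
    using has_integral_Beta_real[OF assms(2,1)] by simp
  from has_integral_affinity[OF this, of "1 / d" "- s / d"] d
  have "((\<lambda>u. (u / d - s / d) powr (b - 1) * (1 - (u / d - s / d)) powr (a - 1)) has_integral d * Beta b a)
      ((\<lambda>x. d * x + s) ` {0..1})" by simp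
  also have "(\<lambda>x. d * x + s) ` {0..1} = {s..t}"
    using d by (simp add: image_affinity_atLeastAtMost d_def)
  \<comment> \<open>The factor clears the powers of \<open>d\<close> that the rescaled integrand
    carries; the Jacobian supplies one more \<open>d\<close>.\<close>
  finally have "((\<lambda>u. d powr (a + b - 2) * ((u / d - s / d) powr (b - 1) * (1 - (u / d - s / d)) powr (a - 1)))
      has_integral d powr (a + b - 2) * (d * Beta b a)) {s..t}"
    by (rule has_integral_mult_right)
  also have "d powr (a + b - 2) * (d * Beta b a) = Beta a b * d powr (a + b - 1)"
  proof -
    have "d powr (a + b - 1) = d powr (a + b - 2 + 1)" by simp
    also have "\<dots> = d powr (a + b - 2) * d" using d by (subst powr_add) simp
    finally show ?thesis by (simp add: Beta_commute)
  qed
  finally show ?thesis unfolding d_def[symmetric]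
  proof (rule has_integral_eq[rotated])
    fix u assume u: "u \<in> {s..t}"
    have e: "u / d - s / d = (u - s) / d" by (simp add: diff_divide_distrib)
    moreover have "1 - (u / d - s / d) = (t - u) / d"
      using d unfolding e by (simp add: divide_simps) (simp add: d_def)
    ultimately have "(u / d - s / d) powr (b - 1) * (1 - (u / d - s / d)) powr (a - 1)
      = (u - s) powr (b - 1) * (t - u) powr (a - 1) / (d powr (b - 1) * d powr (a - 1))"
      using u d by (simp add: powr_divide)
    also have "d powr (b - 1) * d powr (a - 1) = d powr (a + b - 2)"
      by (simp add: powr_add[symmetric] add.commute)
    finally show "d powr (a + b - 2) * ((u / d - s / d) powr (b - 1) * (1 - (u / d - s / d)) powr (a - 1))
      = (t - u) powr (a - 1) * (u - s) powr (b - 1)" using d by simp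
  qed
qed

lemma powr_power_eq:
  fixes u \<alpha> :: real
  assumes "0 < u"
  shows "(u powr \<alpha>) ^ n = u powr (real n * \<alpha>)"
  using assms by (simp add: powr_realpow[symmetric] powr_powr mult.commute)

text \<open>Stated with \<open>(u powr \<alpha>) ^ n\<close> rather than \<open>u powr (n * \<alpha>)\<close>, since \<open>0 powr 0 = 0\<close>.\<close>

lemma fractional_integral_power:
  fixes \<alpha> t :: real
  assumes "0 < \<alpha>" "0 \<le> t"
  shows "((\<lambda>u. (t - u) powr (\<alpha> - 1) * (u powr \<alpha>) ^ n) has_integral
    Gamma \<alpha> * Gamma (real n * \<alpha> + 1) / Gamma (real (Suc n) * \<alpha> + 1) * (t powr \<alpha>) ^ Suc n) {0..t}"
proof (cases "t = 0")
  case True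
  then show ?thesis using assms by (simp add: has_integral_refl)
next
  case False
  with assms have t: "0 < t" by simp
  have "0 < real n * \<alpha> + 1" using assms by (simp add: add_nonneg_pos)
  from has_integral_Beta_interval[OF assms(1) this t]
  have "((\<lambda>u. (t - u) powr (\<alpha> - 1) * u powr (real n * \<alpha>)) has_integral
      Beta \<alpha> (real n * \<alpha> + 1) * t powr (real (Suc n) * \<alpha>)) {0..t}"
    by (simp add: algebra_simps)
  also have "Beta \<alpha> (real n * \<alpha> + 1) * t powr (real (Suc n) * \<alpha>) =
      Gamma \<alpha> * Gamma (real n * \<alpha> + 1) / Gamma (real (Suc n) * \<alpha> + 1) * (t powr \<alpha>) ^ Suc n"
    by (simp only: powr_power_eq[OF t] Beta_def) (simp add: algebra_simps)
  finally show ?thesis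
    by (rule has_integral_spike_finite[rotated 2, of _ _ _ "{0}"]) (auto simp: powr_power_eq)
qed

section \<open>The exact solution and its Caputo derivative\<close>

lemma exact_sol_has_derivative:
  assumes "0 < \<alpha>" "\<alpha> < 1" "0 < t"
  shows "(exact_sol \<alpha> lam x0 has_real_derivative
    x0 * (mittag_leffler_deriv \<alpha> (lam * t powr \<alpha>) * (lam * (\<alpha> * t powr (\<alpha> - 1))))) (at t)"
  unfolding exact_sol_def[abs_def] using assms
  by (intro DERIV_cmult DERIV_chain2[OF mittag_leffler_has_derivative] has_real_derivative_powr)

lemma exact_sol_continuous:
  assumes "0 < \<alpha>" "\<alpha> < 1"
  shows "continuous_on {0..} (exact_sol \<alpha> lam x0)"
proof -
  have cont: "continuous_on UNIV (mittag_leffler \<alpha>)"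
    using mittag_leffler_has_derivative[OF assms] by (meson DERIV_continuous_on has_field_derivative_at_within)
  have "continuous_on {0..} (\<lambda>t::real. lam * t powr \<alpha>)"
    using assms by (intro continuous_intros continuous_on_powr') auto
  then have "continuous_on {0..} (\<lambda>t. mittag_leffler \<alpha> (lam * t powr \<alpha>))"
    by (rule continuous_on_compose2[OF cont]) auto
  then show ?thesis unfolding exact_sol_def[abs_def] by (intro continuous_intros)
qed

lemma exact_sol_0: "0 < \<alpha> \<Longrightarrow> exact_sol \<alpha> lam x0 0 = x0"
proof -
  have "(\<Sum>n. 1 / Gamma (real n * \<alpha> + 1) * 0 ^ n) = (1::real)"
    using powser_zero[of "\<lambda>n. 1 / Gamma (real n * \<alpha> + 1)"] by simp
  then show "exact_sol \<alpha> lam x0 0 = x0" by (simp add: exact_sol_def mittag_leffler_eq)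
qed

text \<open>The derivative is a series of powers s^((n + 1) \<alpha> - 1), and each term integrates
  against the kernel to a Beta value. Dividing by Gamma ((n + 1) \<alpha>) turns this into Gamma (1
  - \<alpha>) times the n-th Mittag-Leffler term, an index shift that leaves one factor
  \<open>lam\<close> over. \<open>D\<close> is prescribed only for s > 0, so the derivative of any
  function agreeing with the solution on the half-line can be inserted.\<close>

lemma exact_sol_caputo:
  assumes \<alpha>: "0 < \<alpha>" "\<alpha> < 1" and t: "0 < t"
    and D: "\<And>s. 0 < s \<Longrightarrow> D s = x0 * (mittag_leffler_deriv \<alpha> (lam * s powr \<alpha>) * (lam * (\<alpha> * s powr (\<alpha> - 1))))"
  shows "(\<lambda>s. D s / (t - s) powr \<alpha>) absolutely_integrable_on {0..t}"
    and "integral {0..t} (\<lambda>s. D s / (t - s) powr \<alpha>) = Gamma (1 - \<alpha>) * (lam * exact_sol \<alpha> lam x0 t)"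
proof -
  define p where "p n s = (t - s) powr (- \<alpha>) * s powr (real (Suc n) * \<alpha> - 1)" for n s
  define d where "d n = x0 * lam ^ Suc n / Gamma (real (Suc n) * \<alpha>)" for n
  define I where "I n = Beta (1 - \<alpha>) (real (Suc n) * \<alpha>) * (t powr \<alpha>) ^ n" for n
  have I: "(p n has_integral I n) {0..t}" for n
  proof -
    have "0 < real (Suc n) * \<alpha>" using \<alpha> by simp
    from has_integral_Beta_interval[of "1 - \<alpha>", OF _ this t] \<alpha> show ?thesis
      by (simp add: p_def[abs_def] I_def powr_power_eq[OF t] algebra_simps)
  qed
  have p_nonneg: "0 \<le> p n s" for n s by (simp add: p_def)
  have abs_p: "p n absolutely_integrable_on {0..t}" for n
    using I p_nonneg by (intro nonnegative_absolutely_integrable_1) (auto simp: integrable_on_def)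
  have int_p: "integrable lebesgue (\<lambda>s. indicator {0..t} s * p n s)"
    "(\<integral>s. indicator {0..t} s * p n s \<partial>lebesgue) = I n" for n
    using abs_p[of n] set_lebesgue_integral_eq_integral(2)[OF abs_p[of n]] I[of n]
    by (auto simp: set_integrable_def set_lebesgue_integral_def dest: integral_unique)
  have GI: "I n / Gamma (real (Suc n) * \<alpha>) = Gamma (1 - \<alpha>) * (1 / Gamma (real n * \<alpha> + 1) * (t powr \<alpha>) ^ n)" for n
  proof -
    have "Gamma (real (Suc n) * \<alpha>) > 0" using \<alpha> by (intro Gamma_real_pos) simp
    moreover have e: "1 - \<alpha> + real (Suc n) * \<alpha> = real n * \<alpha> + 1" by (simp add: algebra_simps)
    ultimately show ?thesis unfolding I_def Beta_def e by simp
  qed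
  define f where "f n s = d n * (indicator {0..t} s * p n s)" for n s
  have f_int: "integrable lebesgue (f n)" for n
    unfolding f_def[abs_def] using int_p by simp
  have f_integral: "(\<integral>s. f n s \<partial>lebesgue) = d n * I n" for n
    unfolding f_def[abs_def] using int_p by simp
  have f_norm: "(\<integral>s. norm (f n s) \<partial>lebesgue) = \<bar>d n\<bar> * I n" for n
  proof -
    have "norm (f n s) = \<bar>d n\<bar> * (indicator {0..t} s * p n s)" for s
      using p_nonneg[of n s] by (simp add: f_def abs_mult)
    then show ?thesis using int_p by simp
  qed
  have dI: "d n * I n = Gamma (1 - \<alpha>) * lam * x0 * (1 / Gamma (real n * \<alpha> + 1) * (lam * t powr \<alpha>) ^ n)" for n
  proof -
    have "d n * I n = x0 * lam ^ Suc n * (I n / Gamma (real (Suc n) * \<alpha>))" by (simp add: d_def)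
    then show ?thesis unfolding GI by (simp add: power_mult_distrib)
  qed
  have adI: "\<bar>d n\<bar> * I n = Gamma (1 - \<alpha>) * \<bar>lam\<bar> * \<bar>x0\<bar> * (1 / Gamma (real n * \<alpha> + 1) * (\<bar>lam\<bar> * t powr \<alpha>) ^ n)" for n
  proof -
    have "Gamma (real (Suc n) * \<alpha>) > 0" using \<alpha> by (intro Gamma_real_pos) simp
    then have "\<bar>d n\<bar> * I n = \<bar>x0\<bar> * \<bar>lam\<bar> ^ Suc n * (I n / Gamma (real (Suc n) * \<alpha>))"
      by (simp add: d_def abs_mult power_abs)
    then show ?thesis unfolding GI by (simp add: power_mult_distrib)
  qed
  \<comment> \<open>At s = t both sides are 0, because \<open>0 powr (- \<alpha>) = 0\<close> and
    division by 0 gives 0.\<close>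
  have sums_D: "(\<lambda>n. d n * p n s) sums (D s / (t - s) powr \<alpha>)" if "0 < s" for s
  proof -
    have "(\<lambda>n. (x0 * (lam * (\<alpha> * s powr (\<alpha> - 1))) / (t - s) powr \<alpha>) *
        ((lam * s powr \<alpha>) ^ n / (\<alpha> * Gamma (real (Suc n) * \<alpha>))))
      sums ((x0 * (lam * (\<alpha> * s powr (\<alpha> - 1))) / (t - s) powr \<alpha>) * mittag_leffler_deriv \<alpha> (lam * s powr \<alpha>))"
      by (intro sums_mult mittag_leffler_deriv_sums \<alpha>)
    moreover have "(x0 * (lam * (\<alpha> * s powr (\<alpha> - 1))) / (t - s) powr \<alpha>) *
        ((lam * s powr \<alpha>) ^ n / (\<alpha> * Gamma (real (Suc n) * \<alpha>))) = d n * p n s" for n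
    proof -
      have "s powr (real (Suc n) * \<alpha> - 1) = s powr (\<alpha> - 1 + real n * \<alpha>)" by (simp add: algebra_simps)
      also have "\<dots> = s powr (\<alpha> - 1) * (s powr \<alpha>) ^ n" by (simp only: powr_add powr_power_eq[OF that])
      finally show ?thesis
        using \<alpha> by (simp add: d_def p_def powr_minus power_mult_distrib field_simps)
    qed
    ultimately show ?thesis by (simp add: D[OF that] mult_ac)
  qed
  have abs_sum: "summable (\<lambda>n. norm (f n s))" for s
  proof (cases "0 < s")
    case True
    have "(\<lambda>n. (\<bar>x0\<bar> * (\<bar>lam\<bar> * (\<alpha> * s powr (\<alpha> - 1))) / (t - s) powr \<alpha>) *
        ((\<bar>lam\<bar> * s powr \<alpha>) ^ n / (\<alpha> * Gamma (real (Suc n) * \<alpha>))))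
      sums ((\<bar>x0\<bar> * (\<bar>lam\<bar> * (\<alpha> * s powr (\<alpha> - 1))) / (t - s) powr \<alpha>) * mittag_leffler_deriv \<alpha> (\<bar>lam\<bar> * s powr \<alpha>))"
      by (intro sums_mult mittag_leffler_deriv_sums \<alpha>)
    moreover have "(\<bar>x0\<bar> * (\<bar>lam\<bar> * (\<alpha> * s powr (\<alpha> - 1))) / (t - s) powr \<alpha>) *
        ((\<bar>lam\<bar> * s powr \<alpha>) ^ n / (\<alpha> * Gamma (real (Suc n) * \<alpha>))) = \<bar>d n\<bar> * p n s" for n
    proof -
      have "Gamma (real (Suc n) * \<alpha>) > 0" using \<alpha> by (intro Gamma_real_pos) simp
      then have ad: "\<bar>d n\<bar> = \<bar>x0\<bar> * \<bar>lam\<bar> ^ Suc n / Gamma (real (Suc n) * \<alpha>)"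
        by (simp add: d_def abs_mult power_abs)
      have "s powr (real (Suc n) * \<alpha> - 1) = s powr (\<alpha> - 1 + real n * \<alpha>)" by (simp add: algebra_simps)
      also have "\<dots> = s powr (\<alpha> - 1) * (s powr \<alpha>) ^ n" by (simp only: powr_add powr_power_eq[OF True])
      finally show ?thesis
        using \<alpha> by (simp add: ad p_def powr_minus power_mult_distrib field_simps)
    qed
    ultimately have "summable (\<lambda>n. \<bar>d n\<bar> * p n s)" by (simp add: sums_iff)
    then have "summable (\<lambda>n. indicator {0..t} s * (\<bar>d n\<bar> * p n s))" by (rule summable_mult)
    moreover have "norm (f n s) = indicator {0..t} s * (\<bar>d n\<bar> * p n s)" for n
      using p_nonneg[of n s] by (simp add: f_def abs_mult)
    ultimately show ?thesis by simp
  next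
    case False
    then have "f n s = 0" for n by (cases "s = 0") (auto simp: f_def p_def)
    then show ?thesis by simp
  qed
  \<comment> \<open>The integrals of the absolute values form a Mittag-Leffler series at |lam|
    t^\<alpha>, which justifies exchanging sum and integral.\<close>
  have norm_sum: "summable (\<lambda>n. \<integral>s. norm (f n s) \<partial>lebesgue)"
    unfolding f_norm adI by (intro summable_mult mittag_leffler_summable \<alpha>)
  define F where "F s = (\<Sum>n. f n s)" for s
  have F_int: "integrable lebesgue F"
    unfolding F_def[abs_def] by (rule integrable_suminf[OF f_int AE_I2[OF abs_sum] norm_sum])
  have F_integral: "(\<integral>s. F s \<partial>lebesgue) = Gamma (1 - \<alpha>) * (lam * exact_sol \<alpha> lam x0 t)"
  proof -
    have "(\<integral>s. F s \<partial>lebesgue) = (\<Sum>n. d n * I n)"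
      unfolding F_def f_integral[symmetric]
      by (rule integral_suminf[OF f_int AE_I2[OF abs_sum] norm_sum])
    also have "\<dots> = Gamma (1 - \<alpha>) * lam * x0 * (\<Sum>n. 1 / Gamma (real n * \<alpha> + 1) * (lam * t powr \<alpha>) ^ n)"
      unfolding dI by (intro suminf_mult mittag_leffler_summable \<alpha>)
    finally show ?thesis by (simp add: exact_sol_def mittag_leffler_eq)
  qed
  have F_eq: "(\<lambda>s. indicat_real {0..t} s *\<^sub>R F s) = F"
    by (auto simp: F_def f_def fun_eq_iff indicator_def)
  have F_abs: "F absolutely_integrable_on {0..t}"
    unfolding set_integrable_def F_eq by (rule F_int)
  have F_hk: "integral {0..t} F = Gamma (1 - \<alpha>) * (lam * exact_sol \<alpha> lam x0 t)"
    using set_lebesgue_integral_eq_integral(2)[OF F_abs] F_integral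
    unfolding set_lebesgue_integral_def F_eq by simp
  have DF: "D s / (t - s) powr \<alpha> = F s" if "s \<in> {0..t} - {0}" for s
    using sums_D[of s] that by (simp add: F_def f_def sums_iff)
  show "(\<lambda>s. D s / (t - s) powr \<alpha>) absolutely_integrable_on {0..t}"
    by (rule absolutely_integrable_spike[OF F_abs, of "{0}"]) (use DF in auto)
  show "integral {0..t} (\<lambda>s. D s / (t - s) powr \<alpha>) = Gamma (1 - \<alpha>) * (lam * exact_sol \<alpha> lam x0 t)"
    unfolding F_hk[symmetric]
    by (rule integral_spike[of "{0}"]) (use DF in auto)
qed

lemma exact_sol_is_solution:
  assumes \<alpha>: "0 < \<alpha>" "\<alpha> < 1" and X: "\<And>t. 0 \<le> t \<Longrightarrow> X t = exact_sol \<alpha> lam x0 t"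
  shows "fode_solution \<alpha> lam x0 X"
proof -
  have der: "(X has_real_derivative
      x0 * (mittag_leffler_deriv \<alpha> (lam * t powr \<alpha>) * (lam * (\<alpha> * t powr (\<alpha> - 1))))) (at t)" if "0 < t" for t
    by (rule has_field_derivative_transform_within_open[OF exact_sol_has_derivative[OF \<alpha> that], of "{0<..}"])
      (use that X in auto)
  have "continuous_on {0..} X"
    by (rule continuous_on_eq[OF exact_sol_continuous[OF \<alpha>, of lam x0]]) (use X in auto)
  moreover have "X differentiable (at t)" if "0 < t" for t
    using der[OF that] real_differentiable_def by blast
  moreover have D: "deriv X s = x0 * (mittag_leffler_deriv \<alpha> (lam * s powr \<alpha>) * (lam * (\<alpha> * s powr (\<alpha> - 1))))"
    if "0 < s" for s using der[OF that] by (rule DERIV_imp_deriv)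
  moreover have "Gamma (1 - \<alpha>) > 0" using \<alpha> by (intro Gamma_real_pos) simp
  ultimately show ?thesis
    using exact_sol_caputo[OF \<alpha> _ D] exact_sol_0[OF \<alpha>(1)] X
    by (auto simp: fode_solution_def caputo_deriv_def)
qed

section \<open>The fractional Volterra equation\<close>

text \<open>A bridge between the Lebesgue integrals of the Caputo derivative and
  \<open>lborel\<close>, the measure for which Fubini is applied.\<close>

lemma absolutely_integrable_imp_lborel:
  fixes f :: "real \<Rightarrow> real"
  assumes f: "f absolutely_integrable_on S" and [measurable]: "f \<in> borel_measurable borel" "S \<in> sets borel"
  shows "integrable lborel (\<lambda>x. indicator S x * f x)"
    and "(\<integral>x. indicator S x * f x \<partial>lborel) = integral S f"
proof -
  have m: "(\<lambda>x. indicator S x * f x) \<in> borel_measurable lborel" by measurable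
  show "integrable lborel (\<lambda>x. indicator S x * f x)"
    using f integrable_completion[OF m] by (simp add: set_integrable_def)
  show "(\<integral>x. indicator S x * f x \<partial>lborel) = integral S f"
    using set_lebesgue_integral_eq_integral(2)[OF f] integral_completion[OF m]
    by (simp add: set_lebesgue_integral_def)
qed

lemma fractional_kernel_has_integral:
  fixes \<alpha> t :: real
  assumes "0 < \<alpha>" "0 \<le> t"
  shows "((\<lambda>u. (t - u) powr (\<alpha> - 1)) has_integral t powr \<alpha> / \<alpha>) {0..t}"
proof -
  have "Gamma (\<alpha> + 1) = \<alpha> * Gamma \<alpha>" "Gamma \<alpha> \<noteq> 0"
    using assms Gamma_real_pos[of \<alpha>]
    by (auto intro!: Gamma_plus1 elim!: nonpos_Ints_cases simp del: Gamma_real_pos)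
  then show ?thesis using fractional_integral_power[OF assms, of 0] assms by simp
qed

lemma fractional_kernel_mult_absolutely_integrable:
  fixes \<alpha> t :: real
  assumes "0 < \<alpha>" "0 \<le> t" "continuous_on {0..t} X"
  shows "(\<lambda>u. (t - u) powr (\<alpha> - 1) * X u) absolutely_integrable_on {0..t}"
proof -
  have "(\<lambda>u. X u * (t - u) powr (\<alpha> - 1)) absolutely_integrable_on {0..t}"
  proof (rule absolutely_integrable_bounded_measurable_product_real)
    show "X \<in> borel_measurable (lebesgue_on {0..t})"
      using assms by (intro continuous_imp_measurable_on_sets_lebesgue) auto
    show "bounded (X ` {0..t})"
      using assms by (intro compact_imp_bounded compact_continuous_image) auto
    show "(\<lambda>u. (t - u) powr (\<alpha> - 1)) absolutely_integrable_on {0..t}"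
      using fractional_kernel_has_integral[OF assms(1,2)]
      by (intro nonnegative_absolutely_integrable_1) (auto simp: integrable_on_def)
  qed simp
  then show ?thesis by (simp add: mult.commute)
qed

text \<open>The derivative is a pointwise limit of difference quotients with increments 1 / (n + 1).
  Extending X by its value at 0 makes these quotients Borel on the whole line.\<close>

lemma borel_measurable_deriv_positive:
  fixes X :: "real \<Rightarrow> real"
  assumes cont: "continuous_on {0..} X" and diff: "\<And>t. 0 < t \<Longrightarrow> X differentiable (at t)"
  shows "(\<lambda>s. indicator {0<..} s * deriv X s) \<in> borel_measurable borel"
proof -
  define Z where "Z s = X (max 0 s)" for s
  have "continuous_on UNIV Z"
    unfolding Z_def by (rule continuous_on_compose2[OF cont]) (auto intro!: continuous_intros)
  then have [measurable]: "Z \<in> borel_measurable borel" by (rule borel_measurable_continuous_onI)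
  define g where "g n s = indicator {0<..} s * ((Z (s + inverse (real (Suc n))) - Z s) / inverse (real (Suc n)))" for n s
  show ?thesis
  proof (rule borel_measurable_LIMSEQ_real)
    show "g n \<in> borel_measurable borel" for n unfolding g_def[abs_def] by measurable
    fix s :: real
    show "(\<lambda>n. g n s) \<longlonglongrightarrow> indicator {0<..} s * deriv X s"
    proof (cases "0 < s")
      case True
      have "(X has_real_derivative deriv X s) (at s)"
        using diff[OF True] by (metis DERIV_imp_deriv real_differentiable_def)
      then have "((\<lambda>h. (X (s + h) - X s) / h) \<longlongrightarrow> deriv X s) (at 0)" by (simp add: DERIV_def)
      moreover have "filterlim (\<lambda>n. inverse (real (Suc n))) (at 0) sequentially"
        using LIMSEQ_inverse_real_of_nat by (simp add: filterlim_at)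
      ultimately have "(\<lambda>n. (X (s + inverse (real (Suc n))) - X s) / inverse (real (Suc n))) \<longlonglongrightarrow> deriv X s"
        by (rule filterlim_compose)
      moreover have "g n s = (X (s + inverse (real (Suc n))) - X s) / inverse (real (Suc n))" for n
      proof -
        have "0 < s + inverse (real (Suc n))" using True by (intro add_pos_pos) auto
        then show ?thesis using True by (simp add: g_def Z_def max_def)
      qed
      ultimately show ?thesis using True by simp
    qed (simp add: g_def)
  qed
qed

text \<open>Fubini on the triangle \<open>0 < s < u < t\<close>: fractional integration of order \<open>\<alpha>\<close> undoes the
  Caputo derivative because \<open>Beta \<alpha> (1 - \<alpha>) = Gamma \<alpha> * Gamma (1 - \<alpha>)\<close>.\<close>

lemma fode_solution_volterra:
  assumes \<alpha>: "0 < \<alpha>" "\<alpha> < 1" and sol: "fode_solution \<alpha> lam x0 X" and t: "0 \<le> t"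
  shows "X t = x0 + lam / Gamma \<alpha> * integral {0..t} (\<lambda>u. (t - u) powr (\<alpha> - 1) * X u)"
proof (cases "t = 0")
  case True
  then show ?thesis using sol by (simp add: fode_solution_def)
next
  case False
  with t have t: "0 < t" by simp
  have X0: "X 0 = x0" and cont: "continuous_on {0..} X"
    and diff: "\<And>t. 0 < t \<Longrightarrow> X differentiable (at t)"
    and Xabs: "\<And>t. 0 < t \<Longrightarrow> (\<lambda>s. deriv X s / (t - s) powr \<alpha>) absolutely_integrable_on {0..t}"
    and cap: "\<And>t. 0 < t \<Longrightarrow> caputo_deriv \<alpha> X t = lam * X t"
    using sol by (auto simp: fode_solution_def)
  define G1 where "G1 = Gamma (1 - \<alpha>)"
  have G1: "G1 > 0" using \<alpha> unfolding G1_def by (intro Gamma_real_pos) simp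
  have Gpos: "Gamma \<alpha> > 0" using \<alpha> by (intro Gamma_real_pos) simp
  define f where "f s = indicator {0<..} s * deriv X s" for s
  have f_meas [measurable]: "f \<in> borel_measurable borel"
    unfolding f_def[abs_def] by (rule borel_measurable_deriv_positive[OF cont diff])
  have f_eq: "f s = deriv X s" if "0 < s" for s using that by (simp add: f_def)
  define Z where "Z s = X (max 0 s)" for s
  have contZ: "continuous_on UNIV Z"
    unfolding Z_def by (rule continuous_on_compose2[OF cont]) (auto intro!: continuous_intros)
  then have Z_meas [measurable]: "Z \<in> borel_measurable borel" by (rule borel_measurable_continuous_onI)
  have f_abs: "(\<lambda>s. f s / (u - s) powr \<alpha>) absolutely_integrable_on {0..u}"
    and f_int: "integral {0..u} (\<lambda>s. f s / (u - s) powr \<alpha>) = G1 * (lam * X u)" if "0 < u" for u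
  proof -
    show "(\<lambda>s. f s / (u - s) powr \<alpha>) absolutely_integrable_on {0..u}"
      by (rule absolutely_integrable_spike[OF Xabs[OF that], of "{0}"]) (auto simp: f_eq)
    have "integral {0..u} (\<lambda>s. f s / (u - s) powr \<alpha>) = integral {0..u} (\<lambda>s. deriv X s / (u - s) powr \<alpha>)"
      by (rule integral_spike[of "{0}"]) (auto simp: f_eq)
    also have "\<dots> = G1 * (lam * X u)"
      using cap[OF that] G1 by (simp add: caputo_deriv_def G1_def[symmetric] field_simps)
    finally show "integral {0..u} (\<lambda>s. f s / (u - s) powr \<alpha>) = G1 * (lam * X u)" .
  qed
  \<comment> \<open>Multiplying the Caputo integrand by the bounded function (t - s)^\<alpha>
    returns the derivative itself, except at s = t.\<close>
  have f_abs_t: "f absolutely_integrable_on {0..t}"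
  proof -
    have "(\<lambda>s. (t - s) powr \<alpha> * (f s / (t - s) powr \<alpha>)) absolutely_integrable_on {0..t}"
    proof (rule absolutely_integrable_bounded_measurable_product_real)
      have "continuous_on {0..t} (\<lambda>s. (t - s) powr \<alpha>)"
        using \<alpha> by (intro continuous_on_powr' continuous_intros) auto
      then show "(\<lambda>s. (t - s) powr \<alpha>) \<in> borel_measurable (lebesgue_on {0..t})"
        "bounded ((\<lambda>s. (t - s) powr \<alpha>) ` {0..t})"
        by (auto intro!: continuous_imp_measurable_on_sets_lebesgue compact_imp_bounded compact_continuous_image)
    qed (use f_abs[OF t] in auto)
    then show ?thesis by (rule absolutely_integrable_spike[of _ _ "{t}"]) auto
  qed
  have f_integral: "integral {0..t} f = X t - x0"
  proof -
    have "(f has_integral (X t - X 0)) {0..t}"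
    proof (rule fundamental_theorem_of_calculus_interior)
      show "continuous_on {0..t} X" by (rule continuous_on_subset[OF cont]) auto
      fix s assume "s \<in> {0<..<t}"
      then have "(X has_real_derivative f s) (at s)"
        using diff[of s] f_eq[of s] by (metis DERIV_imp_deriv real_differentiable_def greaterThanLessThan_iff)
      then show "(X has_vector_derivative f s) (at s)"
        by (simp add: has_real_derivative_iff_has_vector_derivative)
    qed (use t in simp)
    then show ?thesis by (simp add: X0 integral_unique)
  qed
  note f_lb = absolutely_integrable_imp_lborel[OF f_abs_t f_meas, simplified f_integral]
  define B where "B = Beta \<alpha> (1 - \<alpha>)"
  define K where "K s u = (t - u) powr (\<alpha> - 1) * (u - s) powr (- \<alpha>)" for s u
  have K_meas [measurable]: "K s \<in> borel_measurable borel" for s unfolding K_def[abs_def] by measurable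
  \<comment> \<open>The exponents add up so that the power of t - s is 0: the integral is the same
    for all s < t.\<close>
  have K_lb: "integrable lborel (\<lambda>u. indicator {s..t} u * K s u)"
    "(\<integral>u. indicator {s..t} u * K s u \<partial>lborel) = B" if "s < t" for s
  proof -
    have hi: "(K s has_integral B) {s..t}"
      using has_integral_Beta_interval[OF \<alpha>(1) _ that, of "1 - \<alpha>"] \<alpha> that
      by (simp add: K_def[abs_def] B_def)
    have "K s absolutely_integrable_on {s..t}"
      using hi by (intro nonnegative_absolutely_integrable_1) (auto simp: K_def integrable_on_def)
    from absolutely_integrable_imp_lborel[OF this K_meas] hi
    show "integrable lborel (\<lambda>u. indicator {s..t} u * K s u)"
      "(\<integral>u. indicator {s..t} u * K s u \<partial>lborel) = B"
      by (auto dest: integral_unique)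
  qed
  define H where "H s u = (if 0 \<le> s \<and> s \<le> u \<and> u \<le> t then f s * K s u else 0)" for s u
  have H1: "H s u = indicator {0..t} s * f s * (indicator {s..t} u * K s u)" for s u
    by (auto simp: H_def indicator_def)
  have H2: "H s u = indicator {0..t} u * (t - u) powr (\<alpha> - 1) * (indicator {0..u} s * (f s / (u - s) powr \<alpha>))" for s u
    by (auto simp: H_def indicator_def K_def powr_minus divide_inverse)
  have H_meas: "case_prod H \<in> borel_measurable (lborel \<Otimes>\<^sub>M lborel)"
    unfolding H_def[abs_def] K_def by measurable
  have off_t: "AE s in lborel. s \<noteq> t" by (rule AE_lborel_singleton)
  \<comment> \<open>As the kernel integrates to the constant \<open>B\<close> in u, integrability of
    |H| reduces to that of f.\<close>
  have H_int: "integrable (lborel \<Otimes>\<^sub>M lborel) (case_prod H)"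
  proof (rule lborel_pair.Fubini_integrable[OF H_meas])
    have "integrable lborel (\<lambda>s. \<bar>indicator {0..t} s * f s\<bar> * B)"
      using f_lb(1) by (intro integrable_mult_left integrable_abs) auto
    moreover have "AE s in lborel. (\<integral>u. norm (case_prod H (s, u)) \<partial>lborel) = \<bar>indicator {0..t} s * f s\<bar> * B"
      using off_t
    proof eventually_elim
      case (elim s)
      have "norm (case_prod H (s, u)) = \<bar>indicator {0..t} s * f s\<bar> * (indicator {s..t} u * K s u)" for u
        unfolding prod.case H1 by (simp add: abs_mult K_def)
      then show ?case using K_lb(2)[of s] elim by (cases "s < t") (auto simp: indicator_def)
    qed
    ultimately show "integrable lborel (\<lambda>s. \<integral>u. norm (case_prod H (s, u)) \<partial>lborel)"
    proof (subst integrable_cong_AE[where g="\<lambda>s. \<bar>indicator {0..t} s * f s\<bar> * B"])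
      note [measurable] = H_meas
      show "(\<lambda>s. \<integral>u. norm (case_prod H (s, u)) \<partial>lborel) \<in> borel_measurable lborel"
        by measurable
    qed auto
    show "AE s in lborel. integrable lborel (\<lambda>u. case_prod H (s, u))"
      using off_t
    proof eventually_elim
      case (elim s)
      then show ?case unfolding prod.case H1
        using K_lb(1)[of s] by (cases "s < t") (auto intro!: integrable_mult_right)
    qed
  qed
  \<comment> \<open>Integrating over u first leaves \<open>B\<close> times f, hence X t - x0;
    integrating over s first gives the Caputo derivative at u, hence the fractional integral of lam
    X.\<close>
  have "(\<integral>u. (\<integral>s. H s u \<partial>lborel) \<partial>lborel) = (\<integral>s. (\<integral>u. H s u \<partial>lborel) \<partial>lborel)"
    by (rule lborel_pair.Fubini_integral[OF H_int])
  also have "\<dots> = (\<integral>s. indicator {0..t} s * f s * B \<partial>lborel)"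
  proof (rule integral_cong_AE)
    note [measurable] = H_meas
    show "(\<lambda>s. \<integral>u. H s u \<partial>lborel) \<in> borel_measurable lborel"
      using borel_measurable_integrable[OF lborel_pair.integrable_fst[OF H_int]] by simp
    show "(\<lambda>s. indicator {0..t} s * f s * B) \<in> borel_measurable lborel" by measurable
    show "AE s in lborel. (\<integral>u. H s u \<partial>lborel) = indicator {0..t} s * f s * B"
      using off_t
    proof eventually_elim
      case (elim s)
      then show ?case unfolding H1 using K_lb(2)[of s] by (cases "s < t") (auto simp: indicator_def)
    qed
  qed
  also have "\<dots> = (X t - x0) * B" using f_lb by simp
  finally have fub: "(\<integral>u. (\<integral>s. H s u \<partial>lborel) \<partial>lborel) = (X t - x0) * B" .
  have inner: "(\<integral>s. H s u \<partial>lborel) = indicator {0..t} u * ((t - u) powr (\<alpha> - 1) * Z u) * (G1 * lam)" if "u \<noteq> 0" for u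
  proof (cases "0 < u")
    case True
    have "(\<lambda>s. f s / (u - s) powr \<alpha>) \<in> borel_measurable borel" by measurable
    from absolutely_integrable_imp_lborel[OF f_abs[OF True] this] f_int[OF True]
    have "(\<integral>s. H s u \<partial>lborel) = indicator {0..t} u * (t - u) powr (\<alpha> - 1) * (G1 * (lam * X u))"
      unfolding H2 by (subst integral_mult_right_zero) simp
    then show ?thesis using True by (simp add: Z_def)
  next
    case False
    then have "H s u = 0" for s using that by (auto simp: H_def)
    then show ?thesis using False that by simp
  qed
  have "(\<integral>u. (\<integral>s. H s u \<partial>lborel) \<partial>lborel) =
      (\<integral>u. indicator {0..t} u * ((t - u) powr (\<alpha> - 1) * Z u) * (G1 * lam) \<partial>lborel)"
  proof (rule integral_cong_AE)
    show "(\<lambda>u. \<integral>s. H s u \<partial>lborel) \<in> borel_measurable lborel"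
      using borel_measurable_integrable[OF lborel_pair.integrable_snd[OF H_int]] by simp
    show "(\<lambda>u. indicator {0..t} u * ((t - u) powr (\<alpha> - 1) * Z u) * (G1 * lam)) \<in> borel_measurable lborel"
      by measurable
    show "AE u in lborel. (\<integral>s. H s u \<partial>lborel) = indicator {0..t} u * ((t - u) powr (\<alpha> - 1) * Z u) * (G1 * lam)"
      using AE_lborel_singleton[of 0] by eventually_elim (rule inner)
  qed
  also have "\<dots> = integral {0..t} (\<lambda>u. (t - u) powr (\<alpha> - 1) * Z u) * (G1 * lam)"
  proof -
    have "(\<lambda>u. (t - u) powr (\<alpha> - 1) * Z u) absolutely_integrable_on {0..t}"
      using \<alpha> t contZ by (intro fractional_kernel_mult_absolutely_integrable) (auto intro: continuous_on_subset)
    from absolutely_integrable_imp_lborel(2)[OF this] show ?thesis by simp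
  qed
  also have "integral {0..t} (\<lambda>u. (t - u) powr (\<alpha> - 1) * Z u) = integral {0..t} (\<lambda>u. (t - u) powr (\<alpha> - 1) * X u)"
    by (rule integral_cong) (simp add: Z_def)
  finally have "integral {0..t} (\<lambda>u. (t - u) powr (\<alpha> - 1) * X u) * (G1 * lam) = (X t - x0) * B"
    using fub by simp
  moreover have "B = Gamma \<alpha> * G1" by (simp add: B_def Beta_def G1_def)
  ultimately have "G1 * (lam * integral {0..t} (\<lambda>u. (t - u) powr (\<alpha> - 1) * X u)) = G1 * ((X t - x0) * Gamma \<alpha>)"
    by (simp add: mult_ac)
  then have "lam * integral {0..t} (\<lambda>u. (t - u) powr (\<alpha> - 1) * X u) = (X t - x0) * Gamma \<alpha>"
    using G1 by simp
  then show ?thesis using Gpos by simp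
qed

text \<open>Fractional integration maps each series term to a multiple of the next, so the
  remainders \<open>R n\<close> satisfy R (n + 1) = lam J^\<alpha> (R n). Starting from a bound M of
  |X| on [0, T], |R n| is at most M times the n-th Mittag-Leffler term at |lam| t^\<alpha>, a null
  sequence by convergence of the series.\<close>

lemma volterra_unique:
  assumes \<alpha>: "0 < \<alpha>" "\<alpha> < 1" and cont: "continuous_on {0..} X"
    and V: "\<And>t. 0 \<le> t \<Longrightarrow> X t = x0 + lam / Gamma \<alpha> * integral {0..t} (\<lambda>u. (t - u) powr (\<alpha> - 1) * X u)"
    and T: "0 \<le> T"
  shows "X T = exact_sol \<alpha> lam x0 T"
proof -
  have Gpos: "Gamma \<alpha> > 0" using \<alpha> by (intro Gamma_real_pos) simp
  have Gn: "Gamma (real n * \<alpha> + 1) > 0" for n using \<alpha> by (intro Gamma_real_pos) (simp add: add_nonneg_pos)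
  define S where "S n t = (\<Sum>j<n. 1 / Gamma (real j * \<alpha> + 1) * (lam * t powr \<alpha>) ^ j)" for n t
  define R where "R n t = X t - x0 * S n t" for n t
  have R_int: "((\<lambda>u. (t - u) powr (\<alpha> - 1) * (lam / Gamma \<alpha> * R n u)) has_integral R (Suc n) t) {0..t}"
    if t: "0 \<le> t" for n t
  proof -
    have "((\<lambda>u. (t - u) powr (\<alpha> - 1) * X u) has_integral integral {0..t} (\<lambda>u. (t - u) powr (\<alpha> - 1) * X u)) {0..t}"
      by (intro integrable_integral set_lebesgue_integral_eq_integral(1)
          fractional_kernel_mult_absolutely_integrable \<alpha>(1) t continuous_on_subset[OF cont]) auto
    from has_integral_mult_right[OF this, of "lam / Gamma \<alpha>"] V[OF t]
    have 1: "((\<lambda>u. lam / Gamma \<alpha> * ((t - u) powr (\<alpha> - 1) * X u)) has_integral X t - x0) {0..t}"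
      by simp
    have "((\<lambda>u. \<Sum>j<n. lam / Gamma \<alpha> * x0 * lam ^ j / Gamma (real j * \<alpha> + 1) * ((t - u) powr (\<alpha> - 1) * (u powr \<alpha>) ^ j))
       has_integral (\<Sum>j<n. lam / Gamma \<alpha> * x0 * lam ^ j / Gamma (real j * \<alpha> + 1) *
         (Gamma \<alpha> * Gamma (real j * \<alpha> + 1) / Gamma (real (Suc j) * \<alpha> + 1) * (t powr \<alpha>) ^ Suc j))) {0..t}"
      by (intro has_integral_sum has_integral_mult_right fractional_integral_power \<alpha> t) auto
    also have "(\<Sum>j<n. lam / Gamma \<alpha> * x0 * lam ^ j / Gamma (real j * \<alpha> + 1) *
         (Gamma \<alpha> * Gamma (real j * \<alpha> + 1) / Gamma (real (Suc j) * \<alpha> + 1) * (t powr \<alpha>) ^ Suc j))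
       = x0 * (\<Sum>j<n. 1 / Gamma (real (Suc j) * \<alpha> + 1) * (lam * t powr \<alpha>) ^ Suc j)"
      unfolding sum_distrib_left
    proof (intro sum.cong refl)
      fix j
      have "Gamma (real j * \<alpha> + 1) \<noteq> 0" "Gamma \<alpha> \<noteq> 0" using Gn[of j] Gpos by auto
      then show "lam / Gamma \<alpha> * x0 * lam ^ j / Gamma (real j * \<alpha> + 1) *
         (Gamma \<alpha> * Gamma (real j * \<alpha> + 1) / Gamma (real (Suc j) * \<alpha> + 1) * (t powr \<alpha>) ^ Suc j)
       = x0 * (1 / Gamma (real (Suc j) * \<alpha> + 1) * (lam * t powr \<alpha>) ^ Suc j)"
        by (simp add: power_mult_distrib)
    qed
    finally have 2: "((\<lambda>u. \<Sum>j<n. lam / Gamma \<alpha> * x0 * lam ^ j / Gamma (real j * \<alpha> + 1) * ((t - u) powr (\<alpha> - 1) * (u powr \<alpha>) ^ j))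
       has_integral x0 * (\<Sum>j<n. 1 / Gamma (real (Suc j) * \<alpha> + 1) * (lam * t powr \<alpha>) ^ Suc j)) {0..t}" .
    have "R (Suc n) t = X t - x0 - x0 * (\<Sum>j<n. 1 / Gamma (real (Suc j) * \<alpha> + 1) * (lam * t powr \<alpha>) ^ Suc j)"
      unfolding R_def S_def sum.lessThan_Suc_shift by (simp add: algebra_simps)
    moreover have "(t - u) powr (\<alpha> - 1) * (lam / Gamma \<alpha> * R n u) =
        lam / Gamma \<alpha> * ((t - u) powr (\<alpha> - 1) * X u) -
        (\<Sum>j<n. lam / Gamma \<alpha> * x0 * lam ^ j / Gamma (real j * \<alpha> + 1) * ((t - u) powr (\<alpha> - 1) * (u powr \<alpha>) ^ j))" for u
      unfolding R_def S_def
      by (simp add: right_diff_distrib sum_distrib_left sum_divide_distrib power_mult_distrib mult_ac)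
    ultimately show ?thesis using has_integral_diff[OF 1 2] by simp
  qed
  have "compact (X ` {0..T})"
    by (intro compact_continuous_image continuous_on_subset[OF cont]) auto
  then obtain M where M: "\<And>t. t \<in> {0..T} \<Longrightarrow> \<bar>X t\<bar> \<le> M"
    by (metis compact_imp_bounded bounded_iff imageI real_norm_def)
  have bound: "\<bar>R n t\<bar> \<le> M * (1 / Gamma (real n * \<alpha> + 1) * (\<bar>lam\<bar> * t powr \<alpha>) ^ n)" if "t \<in> {0..T}" for n t
    using that
  proof (induction n arbitrary: t)
    case 0
    then show ?case using M by (simp add: R_def S_def)
  next
    case (Suc n)
    then have t: "0 \<le> t" by simp
    define c where "c = \<bar>lam\<bar> / Gamma \<alpha> * M * \<bar>lam\<bar> ^ n / Gamma (real n * \<alpha> + 1)"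
    have g: "((\<lambda>u. c * ((t - u) powr (\<alpha> - 1) * (u powr \<alpha>) ^ n)) has_integral
      c * (Gamma \<alpha> * Gamma (real n * \<alpha> + 1) / Gamma (real (Suc n) * \<alpha> + 1) * (t powr \<alpha>) ^ Suc n)) {0..t}"
      by (intro has_integral_mult_right fractional_integral_power \<alpha> t)
    have "norm (integral {0..t} (\<lambda>u. (t - u) powr (\<alpha> - 1) * (lam / Gamma \<alpha> * R n u)))
      \<le> integral {0..t} (\<lambda>u. c * ((t - u) powr (\<alpha> - 1) * (u powr \<alpha>) ^ n))"
    proof (rule Henstock_Kurzweil_Integration.integral_norm_bound_integral)
      show "(\<lambda>u. (t - u) powr (\<alpha> - 1) * (lam / Gamma \<alpha> * R n u)) integrable_on {0..t}"
        using R_int[OF t] by blast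
      show "(\<lambda>u. c * ((t - u) powr (\<alpha> - 1) * (u powr \<alpha>) ^ n)) integrable_on {0..t}" using g by blast
      fix u assume u: "u \<in> {0..t}"
      have "norm ((t - u) powr (\<alpha> - 1) * (lam / Gamma \<alpha> * R n u)) = (t - u) powr (\<alpha> - 1) * (\<bar>lam\<bar> / Gamma \<alpha> * \<bar>R n u\<bar>)"
        using Gpos by (simp add: abs_mult)
      also have "\<dots> \<le> (t - u) powr (\<alpha> - 1) * (\<bar>lam\<bar> / Gamma \<alpha> * (M * (1 / Gamma (real n * \<alpha> + 1) * (\<bar>lam\<bar> * u powr \<alpha>) ^ n)))"
        using u Suc Gpos by (intro mult_left_mono Suc.IH) auto
      also have "\<dots> = c * ((t - u) powr (\<alpha> - 1) * (u powr \<alpha>) ^ n)"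
        by (simp add: c_def power_mult_distrib)
      finally show "norm ((t - u) powr (\<alpha> - 1) * (lam / Gamma \<alpha> * R n u)) \<le> c * ((t - u) powr (\<alpha> - 1) * (u powr \<alpha>) ^ n)" .
    qed
    then have "\<bar>R (Suc n) t\<bar> \<le> c * (Gamma \<alpha> * Gamma (real n * \<alpha> + 1) / Gamma (real (Suc n) * \<alpha> + 1) * (t powr \<alpha>) ^ Suc n)"
      unfolding integral_unique[OF g] integral_unique[OF R_int[OF t]] real_norm_def .
    also have "\<dots> = M * (1 / Gamma (real (Suc n) * \<alpha> + 1) * (\<bar>lam\<bar> * t powr \<alpha>) ^ Suc n)"
    proof -
      have "Gamma (real n * \<alpha> + 1) \<noteq> 0" "Gamma \<alpha> \<noteq> 0" using Gn[of n] Gpos by auto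
      then show ?thesis by (simp add: c_def power_mult_distrib)
    qed
    finally show ?case .
  qed
  have "(\<lambda>n. M * (1 / Gamma (real n * \<alpha> + 1) * (\<bar>lam\<bar> * T powr \<alpha>) ^ n)) \<longlonglongrightarrow> 0"
    by (intro summable_LIMSEQ_zero summable_mult mittag_leffler_summable \<alpha>)
  then have "(\<lambda>n. R n T) \<longlonglongrightarrow> 0"
    by (rule Lim_null_comparison[rotated]) (use bound T in auto)
  moreover have "(\<lambda>n. R n T) \<longlonglongrightarrow> X T - x0 * mittag_leffler \<alpha> (lam * T powr \<alpha>)"
    unfolding R_def S_def mittag_leffler_eq
    by (intro tendsto_intros summable_LIMSEQ mittag_leffler_summable \<alpha>)
  ultimately have "X T - x0 * mittag_leffler \<alpha> (lam * T powr \<alpha>) = 0"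
    using LIMSEQ_unique by blast
  then show ?thesis by (simp add: exact_sol_def)
qed

lemma fode_solution_iff_exact_sol:
  assumes "0 < \<alpha>" "\<alpha> < 1"
  shows "fode_solution \<alpha> lam x0 X \<longleftrightarrow> (\<forall>t\<ge>0. X t = exact_sol \<alpha> lam x0 t)"
proof
  assume sol: "fode_solution \<alpha> lam x0 X"
  then have "continuous_on {0..} X" by (simp add: fode_solution_def)
  then show "\<forall>t\<ge>0. X t = exact_sol \<alpha> lam x0 t"
    using volterra_unique[OF assms _ fode_solution_volterra[OF assms sol]] by blast
qed (use exact_sol_is_solution[OF assms] in blast)

section \<open>Comparison of the scheme with the exact solution\<close>

lemma fractional_kernel_cell:
  fixes \<alpha> a b t :: real
  assumes "0 < \<alpha>" "a \<le> b" "b \<le> t"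
  shows "((\<lambda>s. (t - s) powr (\<alpha> - 1)) has_integral ((t - a) powr \<alpha> - (t - b) powr \<alpha>) / \<alpha>) {a..b}"
proof -
  have "((\<lambda>s. (t - s) powr (\<alpha> - 1)) has_integral (- ((t - b) powr \<alpha> / \<alpha>) - - ((t - a) powr \<alpha> / \<alpha>))) {a..b}"
  proof (rule fundamental_theorem_of_calculus_interior)
    show "continuous_on {a..b} (\<lambda>s. - ((t - s) powr \<alpha> / \<alpha>))"
      using assms by (intro continuous_intros continuous_on_powr') auto
    fix s assume "s \<in> {a<..<b}"
    then have "((\<lambda>s. - ((t - s) powr \<alpha> / \<alpha>)) has_real_derivative (t - s) powr (\<alpha> - 1)) (at s)"
      using assms by (auto intro!: derivative_eq_intros)
    then show "((\<lambda>s. - ((t - s) powr \<alpha> / \<alpha>)) has_vector_derivative (t - s) powr (\<alpha> - 1)) (at s)"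
      by (simp add: has_real_derivative_iff_has_vector_derivative)
  qed (use assms in simp)
  then show ?thesis by (simp add: diff_divide_distrib)
qed

text \<open>The kernel is nonnegative and its integral over a cell is a weight
  \<open>coeff_a\<close> up to constants, so bounding X on each cell suffices. The one-sided form
  serves both the monotone comparison and, applied to E and -E, the consistency estimate.\<close>

lemma fractional_integral_le_sum:
  fixes \<alpha> k :: real and y :: "nat \<Rightarrow> real"
  assumes \<alpha>: "0 < \<alpha>" and k: "0 < k" and cont: "continuous_on {0..real n * k} X"
    and y: "\<And>m s. \<lbrakk>1 \<le> m; m \<le> n; (real m - 1) * k \<le> s; s \<le> real m * k\<rbrakk> \<Longrightarrow> X s \<le> y m"
  shows "1 / Gamma \<alpha> * integral {0..real n * k} (\<lambda>u. (real n * k - u) powr (\<alpha> - 1) * X u)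
    \<le> k powr \<alpha> * (\<Sum>m=1..n. coeff_a \<alpha> (n - m) * y m)"
proof -
  have Gpos: "Gamma \<alpha> > 0" using \<alpha> by (intro Gamma_real_pos) simp
  have "\<alpha> \<notin> \<int>\<^sub>\<le>\<^sub>0" using \<alpha> by (auto elim!: nonpos_Ints_cases)
  then have G1: "Gamma (1 + \<alpha>) = \<alpha> * Gamma \<alpha>" using Gamma_plus1[of \<alpha>] by (simp add: add.commute)
  define t where "t = real n * k"
  define g where "g = (\<lambda>u. (t - u) powr (\<alpha> - 1) * X u)"
  have g_int: "g integrable_on {0..t}"
    using fractional_kernel_mult_absolutely_integrable[OF \<alpha> _ cont] k
    unfolding g_def t_def by (intro set_lebesgue_integral_eq_integral(1)) simp
  have cell: "integral {(real m - 1) * k..real m * k} g \<le> Gamma \<alpha> * k powr \<alpha> * (coeff_a \<alpha> (n - m) * y m)"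
    if m: "1 \<le> m" "m \<le> n" for m
  proof -
    have mt: "real m * k \<le> t" "0 \<le> (real m - 1) * k" "(real m - 1) * k \<le> real m * k"
      using m k by (auto simp: t_def)
    have ker: "((\<lambda>s. (t - s) powr (\<alpha> - 1) * y m) has_integral
        ((t - (real m - 1) * k) powr \<alpha> - (t - real m * k) powr \<alpha>) / \<alpha> * y m) {(real m - 1) * k..real m * k}"
      using mt by (intro has_integral_mult_left fractional_kernel_cell \<alpha>) auto
    have "t - (real m - 1) * k = (real (n - m) + 1) * k" "t - real m * k = real (n - m) * k"
      using m by (simp_all add: t_def of_nat_diff algebra_simps)
    then have "((t - (real m - 1) * k) powr \<alpha> - (t - real m * k) powr \<alpha>) / \<alpha> =
        k powr \<alpha> * ((real (n - m) + 1) powr \<alpha> - real (n - m) powr \<alpha>) / \<alpha>"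
      by (simp only: powr_mult) (simp add: algebra_simps)
    also have "\<dots> = Gamma \<alpha> * k powr \<alpha> * coeff_a \<alpha> (n - m)"
      using Gpos[THEN less_imp_neq] \<alpha> by (simp add: coeff_a_def G1)
    finally have w: "((t - (real m - 1) * k) powr \<alpha> - (t - real m * k) powr \<alpha>) / \<alpha> = Gamma \<alpha> * k powr \<alpha> * coeff_a \<alpha> (n - m)" .
    have "integral {(real m - 1) * k..real m * k} g \<le>
        integral {(real m - 1) * k..real m * k} (\<lambda>s. (t - s) powr (\<alpha> - 1) * y m)"
    proof (rule integral_le)
      show "g integrable_on {(real m - 1) * k..real m * k}"
        using mt by (intro integrable_on_subinterval[OF g_int]) auto
      show "(\<lambda>s. (t - s) powr (\<alpha> - 1) * y m) integrable_on {(real m - 1) * k..real m * k}"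
        using ker by blast
      show "g s \<le> (t - s) powr (\<alpha> - 1) * y m" if "s \<in> {(real m - 1) * k..real m * k}" for s
        unfolding g_def using y[OF m] that by (intro mult_left_mono) auto
    qed
    also have "\<dots> = Gamma \<alpha> * k powr \<alpha> * (coeff_a \<alpha> (n - m) * y m)"
      using integral_unique[OF ker] unfolding w by (simp add: mult.assoc)
    finally show ?thesis .
  qed
  \<comment> \<open>The cells are added one by one with the kernel kept singular at the fixed time
    t, hence a separate counter l \<le> n.\<close>
  have "integral {0..real l * k} g \<le> (\<Sum>m=1..l. Gamma \<alpha> * k powr \<alpha> * (coeff_a \<alpha> (n - m) * y m))" if "l \<le> n" for l
    using that
  proof (induction l)
    case (Suc l)
    have "real (Suc l) * k \<le> t" unfolding t_def using Suc k by (intro mult_right_mono) auto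
    then have "g integrable_on {0..real (Suc l) * k}"
      by (intro integrable_on_subinterval[OF g_int]) auto
    moreover have "0 \<le> real l * k" "real l * k \<le> real (Suc l) * k" using k by auto
    ultimately have "integral {0..real (Suc l) * k} g =
        integral {0..real l * k} g + integral {real l * k..real (Suc l) * k} g"
      by (metis Henstock_Kurzweil_Integration.integral_combine)
    moreover have "integral {real l * k..real (Suc l) * k} g
        \<le> Gamma \<alpha> * k powr \<alpha> * (coeff_a \<alpha> (n - Suc l) * y (Suc l))"
      using cell[of "Suc l"] Suc.prems by simp
    ultimately show ?case using Suc by simp
  qed simp
  from this[of n] have "integral {0..t} g \<le> Gamma \<alpha> * (k powr \<alpha> * (\<Sum>m=1..n. coeff_a \<alpha> (n - m) * y m))"
    by (simp add: t_def sum_distrib_left mult.assoc)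
  then show ?thesis using Gpos unfolding t_def[symmetric] g_def[symmetric]
    by (simp add: field_simps)
qed

lemma exact_sol_volterra:
  assumes "0 < \<alpha>" "\<alpha> < 1" "0 \<le> t"
  shows "exact_sol \<alpha> lam x0 t =
    x0 + lam * (1 / Gamma \<alpha> * integral {0..t} (\<lambda>u. (t - u) powr (\<alpha> - 1) * exact_sol \<alpha> lam x0 u))"
  using fode_solution_volterra[OF assms(1,2) exact_sol_is_solution[OF assms(1,2)] assms(3)] by simp

lemma exact_sol_mono:
  assumes \<alpha>: "0 < \<alpha>" "\<alpha> < 1" and "0 < lam" "0 < x0" "0 \<le> s" "s \<le> t"
  shows "exact_sol \<alpha> lam x0 s \<le> exact_sol \<alpha> lam x0 t"
proof -
  have "mittag_leffler \<alpha> (lam * s powr \<alpha>) \<le> mittag_leffler \<alpha> (lam * t powr \<alpha>)"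
    unfolding mittag_leffler_eq
  proof (intro suminf_le mittag_leffler_summable \<alpha> mult_left_mono power_mono)
    show "s powr \<alpha> \<le> t powr \<alpha>" using assms by (intro powr_mono2) auto
    show "0 \<le> 1 / Gamma (real n * \<alpha> + 1)" for n
      using \<alpha> Gamma_real_pos[of "real n * \<alpha> + 1"] by (simp add: add_nonneg_pos less_imp_le)
  qed (use assms in auto)
  then show ?thesis using assms by (simp add: exact_sol_def)
qed

lemma exact_sol_le_implicit_scheme:
  assumes \<alpha>: "0 < \<alpha>" "\<alpha> < 1" and lam: "0 < lam" and x0: "0 < x0" and k: "0 < k"
    and small: "k powr \<alpha> * lam < coeff_c \<alpha> 0" and X: "implicit_scheme \<alpha> lam k x0 X"
  shows "exact_sol \<alpha> lam x0 (real n * k) \<le> X n"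
proof (cases "n = 0")
  case True
  then show ?thesis using X exact_sol_0[OF \<alpha>(1)] by (simp add: implicit_scheme_def)
next
  case False
  define h where "h = lam * k powr \<alpha>"
  define E where "E = exact_sol \<alpha> lam x0"
  have a: "0 \<le> coeff_a \<alpha> j" for j using coeff_a_pos[OF \<alpha>(1), of j] by simp
  have "Gamma (1 + \<alpha>) > 0" using \<alpha> by (intro Gamma_real_pos) simp
  then have h: "0 \<le> h" "h * coeff_a \<alpha> 0 < 1"
    using lam small by (simp_all add: h_def coeff_a_0 coeff_c_0[OF \<alpha>(1)] mult.commute)
  have "E (real i * k) - X i \<le> h * (\<Sum>m=1..i. coeff_a \<alpha> (i - m) * (E (real m * k) - X m))" for i
  proof -
    have "1 / Gamma \<alpha> * integral {0..real i * k} (\<lambda>u. (real i * k - u) powr (\<alpha> - 1) * E u)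
      \<le> k powr \<alpha> * (\<Sum>m=1..i. coeff_a \<alpha> (i - m) * E (real m * k))"
    proof (rule fractional_integral_le_sum[OF \<alpha>(1) k])
      show "continuous_on {0..real i * k} E"
        unfolding E_def by (rule continuous_on_subset[OF exact_sol_continuous[OF \<alpha>]]) auto
      fix m s assume m: "1 \<le> m" "(real m - 1) * k \<le> s" "s \<le> real m * k"
      have "0 \<le> (real m - 1) * k" using m k by simp
      then show "E s \<le> E (real m * k)"
        unfolding E_def using m by (intro exact_sol_mono \<alpha> lam x0) auto
    qed
    from mult_left_mono[OF this, of lam]
    have "E (real i * k) \<le> x0 + h * (\<Sum>m=1..i. coeff_a \<alpha> (i - m) * E (real m * k))"
      using lam k exact_sol_volterra[OF \<alpha>, of "real i * k" lam x0] by (simp add: E_def h_def mult.assoc)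
    then show ?thesis using implicit_schemeD[OF \<alpha>(1) k X, of i]
      by (simp add: h_def sum_subtractf right_diff_distrib)
  qed
  from discrete_comparison[where w="\<lambda>i. E (real i * k) - X i" and N=n, OF a h this, of n] False
  show ?thesis by (auto simp: E_def)
qed

section \<open>Hoelder regularity, consistency and convergence\<close>

text \<open>After division by t^\<alpha> this is p \<le> p^\<alpha> on [0, 1], applied to the
  fractions s / t and (t - s) / t, which sum to 1.\<close>

lemma powr_diff_le:
  fixes s t \<alpha> :: real
  assumes "0 < \<alpha>" "\<alpha> < 1" "0 \<le> s" "s \<le> t"
  shows "t powr \<alpha> - s powr \<alpha> \<le> (t - s) powr \<alpha>"
proof (cases "t = 0")
  case False
  with assms have t: "0 < t" by simp
  have le: "p \<le> p powr \<alpha>" if "0 \<le> p" "p \<le> 1" for p :: real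
    using that assms powr_mono'[of \<alpha> 1 p] by (cases "p = 0") auto
  have "1 = s / t + (t - s) / t" using t by (simp add: field_simps)
  also have "\<dots> \<le> (s / t) powr \<alpha> + ((t - s) / t) powr \<alpha>"
    using assms t by (intro add_mono le) auto
  also have "\<dots> = (s powr \<alpha> + (t - s) powr \<alpha>) / t powr \<alpha>"
    using assms t by (simp add: powr_divide add_divide_distrib)
  finally show ?thesis using t by (simp add: field_simps)
qed (use assms in simp)

text \<open>The solution is the differentiable function E_\<alpha> after lam t^\<alpha>. All
  coefficients of the derivative series are positive, so on [-b, b] it is bounded by its value at b,
  and the Hoelder exponent comes from t^\<alpha> alone.\<close>

lemma exact_sol_holder:
  assumes \<alpha>: "0 < \<alpha>" "\<alpha> < 1"
  obtains L where "0 \<le> L"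
    "\<And>s t. \<lbrakk>0 \<le> s; s \<le> t; t \<le> T\<rbrakk> \<Longrightarrow> \<bar>exact_sol \<alpha> lam x0 t - exact_sol \<alpha> lam x0 s\<bar> \<le> L * (t - s) powr \<alpha>"
proof -
  define b where "b = \<bar>lam\<bar> * T powr \<alpha>"
  have b: "0 \<le> b" by (simp add: b_def)
  define B where "B = mittag_leffler_deriv \<alpha> b"
  have der: "\<bar>mittag_leffler_deriv \<alpha> z\<bar> \<le> B" if "\<bar>z\<bar> \<le> b" for z
  proof -
    have pos: "0 < \<alpha> * Gamma (real (Suc n) * \<alpha>)" for n
      using \<alpha> by (intro mult_pos_pos Gamma_real_pos) auto
    have eq: "norm (z ^ n / (\<alpha> * Gamma (real (Suc n) * \<alpha>))) = \<bar>z\<bar> ^ n / (\<alpha> * Gamma (real (Suc n) * \<alpha>))" for n z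
      using pos[of n] by (simp only: real_norm_def abs_divide power_abs abs_of_pos)
    have sm: "summable (\<lambda>n. norm (z ^ n / (\<alpha> * Gamma (real (Suc n) * \<alpha>))))"
      unfolding eq using mittag_leffler_deriv_sums[OF \<alpha>] by (rule sums_summable)
    have "\<bar>mittag_leffler_deriv \<alpha> z\<bar> = norm (\<Sum>n. z ^ n / (\<alpha> * Gamma (real (Suc n) * \<alpha>)))"
      by (subst sums_unique[OF mittag_leffler_deriv_sums[OF \<alpha>], symmetric]) simp
    also have "\<dots> \<le> (\<Sum>n. norm (z ^ n / (\<alpha> * Gamma (real (Suc n) * \<alpha>))))"
      by (rule summable_norm[OF sm])
    also have "\<dots> \<le> (\<Sum>n. b ^ n / (\<alpha> * Gamma (real (Suc n) * \<alpha>)))"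
    proof (rule suminf_le)
      fix n
      show "norm (z ^ n / (\<alpha> * Gamma (real (Suc n) * \<alpha>))) \<le> b ^ n / (\<alpha> * Gamma (real (Suc n) * \<alpha>))"
        unfolding eq using that pos[of n] by (intro divide_right_mono power_mono) auto
    qed (use sm mittag_leffler_deriv_sums[OF \<alpha>] in \<open>auto dest: sums_summable\<close>)
    also have "\<dots> = B"
      unfolding B_def by (rule sums_unique[OF mittag_leffler_deriv_sums[OF \<alpha>], symmetric])
    finally show ?thesis .
  qed
  have B: "0 \<le> B" using der[of 0] b by simp
  show ?thesis
  proof
    show "0 \<le> \<bar>x0\<bar> * B * \<bar>lam\<bar>" using B by simp
    fix s t :: real assume st: "0 \<le> s" "s \<le> t" "t \<le> T"
    have in_b: "\<bar>lam * u powr \<alpha>\<bar> \<le> b" if "0 \<le> u" "u \<le> T" for u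
      unfolding b_def abs_mult using that \<alpha> by (intro mult_left_mono) (auto intro!: powr_mono2)
    have "norm (mittag_leffler \<alpha> (lam * t powr \<alpha>) - mittag_leffler \<alpha> (lam * s powr \<alpha>))
      \<le> B * norm (lam * t powr \<alpha> - lam * s powr \<alpha>)"
    proof (rule field_differentiable_bound[where S="{-b..b}" and f'="mittag_leffler_deriv \<alpha>"])
      show "(mittag_leffler \<alpha> has_field_derivative mittag_leffler_deriv \<alpha> z) (at z within {-b..b})" for z
        using mittag_leffler_has_derivative[OF \<alpha>] by (rule has_field_derivative_at_within)
      show "norm (mittag_leffler_deriv \<alpha> z) \<le> B" if "z \<in> {-b..b}" for z
        using that der[of z] by auto
      show "lam * t powr \<alpha> \<in> {-b..b}" "lam * s powr \<alpha> \<in> {-b..b}"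
        using in_b[of t] in_b[of s] st by auto
    qed auto
    also have "norm (lam * t powr \<alpha> - lam * s powr \<alpha>) = \<bar>lam\<bar> * \<bar>t powr \<alpha> - s powr \<alpha>\<bar>"
      by (simp add: right_diff_distrib[symmetric] abs_mult)
    also have "\<bar>t powr \<alpha> - s powr \<alpha>\<bar> = t powr \<alpha> - s powr \<alpha>"
      using powr_mono2[of \<alpha> s t] \<alpha> st by simp
    also have "B * (\<bar>lam\<bar> * (t powr \<alpha> - s powr \<alpha>)) \<le> B * (\<bar>lam\<bar> * (t - s) powr \<alpha>)"
      using B st by (intro mult_left_mono powr_diff_le \<alpha>) auto
    finally have "\<bar>x0\<bar> * \<bar>mittag_leffler \<alpha> (lam * t powr \<alpha>) - mittag_leffler \<alpha> (lam * s powr \<alpha>)\<bar>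
      \<le> \<bar>x0\<bar> * (B * (\<bar>lam\<bar> * (t - s) powr \<alpha>))" by (intro mult_left_mono) auto
    then show "\<bar>exact_sol \<alpha> lam x0 t - exact_sol \<alpha> lam x0 s\<bar> \<le> \<bar>x0\<bar> * B * \<bar>lam\<bar> * (t - s) powr \<alpha>"
      by (simp add: exact_sol_def right_diff_distrib[symmetric] abs_mult mult.assoc)
  qed
qed

text \<open>On one cell the solution varies by at most \<epsilon> = L k^\<alpha>, while the total
  weight k^\<alpha> (a 0 + ... + a (n - 1)) is at most T^\<alpha> / Gamma (1 + \<alpha>),
  independently of k.\<close>

lemma exact_sol_consistency:
  assumes \<alpha>: "0 < \<alpha>" "\<alpha> < 1" and "0 < T"
  obtains \<rho> where "0 \<le> \<rho>"
    "\<And>k n. \<lbrakk>0 < k; real n * k \<le> T\<rbrakk> \<Longrightarrow>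
      \<bar>exact_sol \<alpha> lam x0 (real n * k) - (x0 + lam * k powr \<alpha> *
         (\<Sum>m=1..n. coeff_a \<alpha> (n - m) * exact_sol \<alpha> lam x0 (real m * k)))\<bar> \<le> \<rho> * k powr \<alpha>"
proof -
  define E where "E = exact_sol \<alpha> lam x0"
  have G: "Gamma (1 + \<alpha>) > 0" using \<alpha> by (intro Gamma_real_pos) simp
  obtain L where L: "0 \<le> L" "\<And>s t. \<lbrakk>0 \<le> s; s \<le> t; t \<le> T\<rbrakk> \<Longrightarrow> \<bar>E t - E s\<bar> \<le> L * (t - s) powr \<alpha>"
    unfolding E_def by (rule exact_sol_holder[OF \<alpha>]) blast
  define \<rho> where "\<rho> = \<bar>lam\<bar> * (L * T powr \<alpha> / Gamma (1 + \<alpha>))"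
  show ?thesis
  proof
    show "0 \<le> \<rho>" using L G by (simp add: \<rho>_def)
    fix k :: real and n assume k: "0 < k" and n: "real n * k \<le> T"
    define \<epsilon> where "\<epsilon> = L * k powr \<alpha>"
    have \<epsilon>: "0 \<le> \<epsilon>" using L by (simp add: \<epsilon>_def)
    have contE: "continuous_on {0..real n * k} E"
      unfolding E_def by (rule continuous_on_subset[OF exact_sol_continuous[OF \<alpha>]]) auto
    have cell: "\<bar>E (real m * k) - E s\<bar> \<le> \<epsilon>"
      if m: "1 \<le> m" "m \<le> n" "(real m - 1) * k \<le> s" "s \<le> real m * k" for m s
    proof -
      have "0 \<le> (real m - 1) * k" using m k by simp
      moreover have "real m * k \<le> T" using m k n by (meson mult_right_mono of_nat_le_iff order_trans less_imp_le)
      ultimately have "\<bar>E (real m * k) - E s\<bar> \<le> L * (real m * k - s) powr \<alpha>" using m by (intro L(2)) auto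
      also have "\<dots> \<le> L * k powr \<alpha>"
        using m \<alpha> L(1) by (intro mult_left_mono powr_mono2) (auto simp: algebra_simps)
      finally show ?thesis by (simp add: \<epsilon>_def)
    qed
    define J where "J = 1 / Gamma \<alpha> * integral {0..real n * k} (\<lambda>u. (real n * k - u) powr (\<alpha> - 1) * E u)"
    define S where "S = k powr \<alpha> * (\<Sum>m=1..n. coeff_a \<alpha> (n - m) * E (real m * k))"
    have kA: "k powr \<alpha> * (\<Sum>m=1..n. coeff_a \<alpha> (n - m) * \<epsilon>) \<le> L * T powr \<alpha> / Gamma (1 + \<alpha>) * k powr \<alpha>"
    proof -
      have "k powr \<alpha> * (\<Sum>m=1..n. coeff_a \<alpha> (n - m) * \<epsilon>) = k powr \<alpha> * (real n powr \<alpha> / Gamma (1 + \<alpha>)) * \<epsilon>"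
        unfolding convolution_sum_flip[where w="\<lambda>_. \<epsilon>"] by (simp add: sum_distrib_right[symmetric] sum_coeff_a)
      also have "\<dots> = (real n * k) powr \<alpha> / Gamma (1 + \<alpha>) * \<epsilon>" using k by (simp add: powr_mult)
      also have "\<dots> \<le> T powr \<alpha> / Gamma (1 + \<alpha>) * \<epsilon>"
        using n k \<alpha> G \<epsilon> by (intro mult_right_mono divide_right_mono powr_mono2) auto
      finally show ?thesis by (simp add: \<epsilon>_def mult_ac)
    qed
    have "J \<le> k powr \<alpha> * (\<Sum>m=1..n. coeff_a \<alpha> (n - m) * (E (real m * k) + \<epsilon>))"
      unfolding J_def by (rule fractional_integral_le_sum[OF \<alpha>(1) k contE]) (use cell in \<open>fastforce simp: abs_le_iff\<close>)
    then have "J - S \<le> k powr \<alpha> * (\<Sum>m=1..n. coeff_a \<alpha> (n - m) * \<epsilon>)"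
      by (simp add: S_def distrib_left sum.distrib)
    moreover have "1 / Gamma \<alpha> * integral {0..real n * k} (\<lambda>u. (real n * k - u) powr (\<alpha> - 1) * - E u)
        \<le> k powr \<alpha> * (\<Sum>m=1..n. coeff_a \<alpha> (n - m) * (- E (real m * k) + \<epsilon>))"
      by (rule fractional_integral_le_sum[OF \<alpha>(1) k])
        (use cell contE in \<open>fastforce simp: abs_le_iff intro: continuous_intros\<close>)+
    then have "S - J \<le> k powr \<alpha> * (\<Sum>m=1..n. coeff_a \<alpha> (n - m) * \<epsilon>)"
      by (simp add: S_def J_def distrib_left sum.distrib right_diff_distrib sum_subtractf)
    ultimately have "\<bar>J - S\<bar> \<le> L * T powr \<alpha> / Gamma (1 + \<alpha>) * k powr \<alpha>" using kA by linarith
    then have "\<bar>lam\<bar> * \<bar>J - S\<bar> \<le> \<bar>lam\<bar> * (L * T powr \<alpha> / Gamma (1 + \<alpha>) * k powr \<alpha>)"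
      by (intro mult_left_mono) auto
    then have "\<bar>lam * (J - S)\<bar> \<le> \<rho> * k powr \<alpha>" by (simp add: \<rho>_def abs_mult mult.assoc)
    moreover have "E (real n * k) = x0 + lam * J"
      using exact_sol_volterra[OF \<alpha>, of "real n * k" lam x0] k by (simp add: E_def J_def)
    ultimately have "\<bar>E (real n * k) - (x0 + lam * S)\<bar> \<le> \<rho> * k powr \<alpha>"
      by (simp add: right_diff_distrib)
    then show "\<bar>exact_sol \<alpha> lam x0 (real n * k) - (x0 + lam * k powr \<alpha> *
         (\<Sum>m=1..n. coeff_a \<alpha> (n - m) * exact_sol \<alpha> lam x0 (real m * k)))\<bar> \<le> \<rho> * k powr \<alpha>"
      by (simp add: E_def S_def mult.assoc)
  qed
qed

lemma implicit_scheme_error: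
  assumes \<alpha>: "0 < \<alpha>" "\<alpha> < 1" and T: "0 < T"
  shows "\<exists>C1. \<forall>\<^sub>F k in at_right 0. \<forall>X. implicit_scheme \<alpha> lam k x0 X \<longrightarrow>
    (SUP n\<in>{n. real n * k \<le> T}. \<bar>X n - exact_sol \<alpha> lam x0 (real n * k)\<bar>) \<le> C1 * k powr \<alpha>"
proof -
  define E where "E = exact_sol \<alpha> lam x0"
  \<comment> \<open>Taking absolute values turns the error equation into a Gronwall inequality with
    |lam|, whatever the sign of \<open>lam\<close>; the added 1 keeps the constant positive when
    \<open>lam\<close> is 0.\<close>
  define \<Lambda> where "\<Lambda> = \<bar>lam\<bar> + 1"
  have \<Lambda>: "0 < \<Lambda>" "\<bar>lam\<bar> \<le> \<Lambda>" by (simp_all add: \<Lambda>_def)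
  have G: "coeff_c \<alpha> 0 > 0" using \<alpha> coeff_c_0[OF \<alpha>(1)] by simp
  obtain C where C: "1 \<le> C"
    "\<forall>k R u n N. 0 < k \<longrightarrow> k powr \<alpha> * \<Lambda> \<le> 1 / 2 * coeff_c \<alpha> 0 \<longrightarrow> 0 \<le> R \<longrightarrow> real N * k \<le> T \<longrightarrow>
       1 \<le> n \<longrightarrow> n \<le> N \<longrightarrow>
       (\<forall>i. 1 \<le> i \<longrightarrow> i \<le> N \<longrightarrow> u i \<le> R + \<Lambda> * k powr \<alpha> * (\<Sum>m=1..i. coeff_a \<alpha> (i - m) * u m)) \<longrightarrow>
       u n \<le> C * R"
    by (rule discrete_gronwall[OF \<alpha> \<Lambda>(1) T]) (rule that)
  obtain \<rho> where \<rho>: "0 \<le> \<rho>"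
    "\<And>k n. \<lbrakk>0 < k; real n * k \<le> T\<rbrakk> \<Longrightarrow>
      \<bar>E (real n * k) - (x0 + lam * k powr \<alpha> * (\<Sum>m=1..n. coeff_a \<alpha> (n - m) * E (real m * k)))\<bar> \<le> \<rho> * k powr \<alpha>"
    unfolding E_def by (rule exact_sol_consistency[OF \<alpha> T]) blast
  have main: "(SUP n\<in>{n. real n * k \<le> T}. \<bar>X n - E (real n * k)\<bar>) \<le> C * \<rho> * k powr \<alpha>"
    if k: "0 < k" "k powr \<alpha> * \<Lambda> \<le> 1 / 2 * coeff_c \<alpha> 0" and X: "implicit_scheme \<alpha> lam k x0 X" for k X
  proof (rule cSUP_least)
    show "{n. real n * k \<le> T} \<noteq> {}" using T by (auto intro!: exI[of _ 0])
    fix n assume n: "n \<in> {n. real n * k \<le> T}"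
    define R where "R = \<rho> * k powr \<alpha>"
    define e where "e i = \<bar>X i - E (real i * k)\<bar>" for i
    have R: "0 \<le> R" using \<rho> by (simp add: R_def)
    have "e n \<le> C * R"
    proof (cases "n = 0")
      case True
      have "e 0 = 0" using X exact_sol_0[OF \<alpha>(1)] by (simp add: e_def E_def implicit_scheme_def)
      then show ?thesis using True C(1) R by simp
    next
      case False
      show ?thesis
      proof (rule C(2)[rule_format, OF k R, where N=n])
        fix i assume i: "1 \<le> i" "i \<le> n"
        have "real i * k \<le> real n * k" using i k(1) by (intro mult_right_mono) auto
        with n have iT: "real i * k \<le> T" by simp
        let ?D = "\<Sum>m=1..i. coeff_a \<alpha> (i - m) * (X m - E (real m * k))"
        have "X i - E (real i * k) = lam * k powr \<alpha> * ?D
          - (E (real i * k) - (x0 + lam * k powr \<alpha> * (\<Sum>m=1..i. coeff_a \<alpha> (i - m) * E (real m * k))))"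
          using implicit_schemeD[OF \<alpha>(1) k(1) X, of i] by (simp add: sum_subtractf right_diff_distrib)
        then have "e i \<le> \<bar>lam * k powr \<alpha> * ?D\<bar> + R"
          using \<rho>(2)[OF k(1) iT] unfolding e_def R_def by linarith
        also have "\<bar>lam * k powr \<alpha> * ?D\<bar> = \<bar>lam\<bar> * k powr \<alpha> * \<bar>?D\<bar>" by (simp add: abs_mult)
        also have "\<dots> \<le> \<Lambda> * k powr \<alpha> * (\<Sum>m=1..i. coeff_a \<alpha> (i - m) * e m)"
        proof (intro mult_mono \<Lambda>)
          show "\<bar>?D\<bar> \<le> (\<Sum>m=1..i. coeff_a \<alpha> (i - m) * e m)"
            using coeff_a_pos[OF \<alpha>(1)]
            by (intro order_trans[OF sum_abs]) (simp add: abs_mult e_def less_imp_le)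
        qed (use \<Lambda> in auto)
        finally show "e i \<le> R + \<Lambda> * k powr \<alpha> * (\<Sum>m=1..i. coeff_a \<alpha> (i - m) * e m)" by simp
      qed (use n False in auto)
    qed
    then show "\<bar>X n - E (real n * k)\<bar> \<le> C * \<rho> * k powr \<alpha>" by (simp add: e_def R_def mult.assoc)
  qed
  \<comment> \<open>The threshold for small steps: b^\<alpha> \<Lambda> is half of
    \<open>coeff_c \<alpha> 0\<close>, the smallness condition of the Gronwall inequality.\<close>
  define b where "b = (coeff_c \<alpha> 0 / (2 * \<Lambda>)) powr (1 / \<alpha>)"
  have b: "0 < b" "b powr \<alpha> = coeff_c \<alpha> 0 / (2 * \<Lambda>)" using G \<Lambda> \<alpha> by (simp_all add: b_def powr_powr)
  have "k powr \<alpha> * \<Lambda> \<le> 1 / 2 * coeff_c \<alpha> 0" if "0 < k" "k < b" for k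
  proof -
    have "k powr \<alpha> \<le> b powr \<alpha>" using that \<alpha> by (intro powr_mono2) auto
    then show ?thesis using \<Lambda>(1) unfolding b(2) by (simp add: field_simps)
  qed
  then have "\<forall>\<^sub>F k in at_right 0. 0 < k \<and> k powr \<alpha> * \<Lambda> \<le> 1 / 2 * coeff_c \<alpha> 0"
    using b(1) by (auto simp: eventually_at_right[of 0 1])
  then show ?thesis using main unfolding E_def
    by (intro exI[of _ "C * \<rho>"]) (auto elim!: eventually_mono)
qed

theorem theorem3p2:
  fixes \<alpha> lam :: real
  assumes "0 < \<alpha>" and "\<alpha> < 1"
  shows
    "(\<forall>x0>0. \<forall>X. fode_solution \<alpha> lam x0 X \<longleftrightarrow> (\<forall>t\<ge>0. X t = exact_sol \<alpha> lam x0 t)) \<and>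
     (\<forall>k>0. \<forall>X.
        (\<forall>n\<ge>1. discrete_caputo \<alpha> k X n = lam * X n) \<longleftrightarrow>
        (\<forall>n\<ge>1. X n = X 0 + lam * k powr \<alpha> * (\<Sum>m=1..n. coeff_a \<alpha> (n - m) * X m))) \<and>
     (lam > 0 \<longrightarrow>
        (\<forall>x0>0. \<forall>k>0. \<forall>X.
           k powr \<alpha> * lam < coeff_c \<alpha> 0 \<longrightarrow> implicit_scheme \<alpha> lam k x0 X \<longrightarrow>
           (\<forall>n. exact_sol \<alpha> lam x0 (real n * k) \<le> X n \<and> X n \<le> X (Suc n)))) \<and>
     (lam < 0 \<longrightarrow>
        (\<forall>x0>0. \<forall>k>0. \<forall>X. implicit_scheme \<alpha> lam k x0 X \<longrightarrow> X \<longlonglongrightarrow> 0)) \<and>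
     (lam > 0 \<longrightarrow>
        (\<forall>x0>0. \<forall>k1>0. \<forall>k2>0. \<forall>m1::nat. \<forall>X1 X2.
           k1 powr \<alpha> * lam < coeff_c \<alpha> 0 \<longrightarrow> k2 powr \<alpha> * lam < coeff_c \<alpha> 0 \<longrightarrow>
           k1 = 2 ^ m1 * k2 \<longrightarrow>
           implicit_scheme \<alpha> lam k1 x0 X1 \<longrightarrow> implicit_scheme \<alpha> lam k2 x0 X2 \<longrightarrow>
           (\<forall>t>0. pw_const k1 X1 t \<ge> pw_const k2 X2 t))) \<and>
     (lam > 0 \<longrightarrow>
        (\<forall>T>0. \<exists>C>0. \<forall>x0>0. \<forall>k>0. \<forall>X.
           k powr \<alpha> * lam \<le> 1 / 2 * coeff_c \<alpha> 0 \<longrightarrow> implicit_scheme \<alpha> lam k x0 X \<longrightarrow>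
           (SUP n\<in>{n. real n * k \<le> T}. X n) \<le> C * X 0)) \<and>
     (\<forall>x0>0. \<forall>T>0. \<exists>C1. \<forall>\<^sub>F k in at_right 0. \<forall>X.
        implicit_scheme \<alpha> lam k x0 X \<longrightarrow>
        (SUP n\<in>{n. real n * k \<le> T}. \<bar>X n - exact_sol \<alpha> lam x0 (real n * k)\<bar>) \<le> C1 * k powr \<alpha>)"
proof -
  note \<alpha> = assms
  have mono: "X n \<le> X (Suc n)"
    if "0 < lam" "0 < x0" "0 < k" "k powr \<alpha> * lam < coeff_c \<alpha> 0" "implicit_scheme \<alpha> lam k x0 X" for x0 k X n
  proof (rule discrete_volterra_mono)
    show "X i = x0 + lam * k powr \<alpha> * (\<Sum>m=1..i. coeff_a \<alpha> (i - m) * X m)" for i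
      using implicit_schemeD[OF \<alpha>(1) that(3,5)] .
    show "lam * k powr \<alpha> * coeff_a \<alpha> 0 < 1"
      using that(4) Gamma_real_pos[of "1 + \<alpha>"] \<alpha> by (simp add: coeff_a_0 coeff_c_0 mult.commute)
  qed (use that coeff_a_pos[OF \<alpha>(1)] in \<open>auto simp: less_imp_le\<close>)
  show ?thesis
  proof (intro conjI)
    show "\<forall>x0>0. \<forall>X. fode_solution \<alpha> lam x0 X \<longleftrightarrow> (\<forall>t\<ge>0. X t = exact_sol \<alpha> lam x0 t)"
      using fode_solution_iff_exact_sol[OF \<alpha>] by blast
  next
    show "\<forall>k>0. \<forall>X.
        (\<forall>n\<ge>1. discrete_caputo \<alpha> k X n = lam * X n) \<longleftrightarrow>
        (\<forall>n\<ge>1. X n = X 0 + lam * k powr \<alpha> * (\<Sum>m=1..n. coeff_a \<alpha> (n - m) * X m))"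
      by (intro allI impI discrete_caputo_eq_iff_volterra \<alpha>(1))
  next
    show "lam > 0 \<longrightarrow> (\<forall>x0>0. \<forall>k>0. \<forall>X.
        k powr \<alpha> * lam < coeff_c \<alpha> 0 \<longrightarrow> implicit_scheme \<alpha> lam k x0 X \<longrightarrow>
        (\<forall>n. exact_sol \<alpha> lam x0 (real n * k) \<le> X n \<and> X n \<le> X (Suc n)))"
    proof (intro impI allI conjI)
      fix x0 k X n
      assume "0 < lam" "0 < x0" "0 < k" "k powr \<alpha> * lam < coeff_c \<alpha> 0" "implicit_scheme \<alpha> lam k x0 X"
      then show "exact_sol \<alpha> lam x0 (real n * k) \<le> X n" "X n \<le> X (Suc n)"
        by (rule exact_sol_le_implicit_scheme[OF \<alpha>], rule mono)
    qed
  next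
    show "lam < 0 \<longrightarrow> (\<forall>x0>0. \<forall>k>0. \<forall>X. implicit_scheme \<alpha> lam k x0 X \<longrightarrow> X \<longlonglongrightarrow> 0)"
    proof (intro impI allI)
      fix x0 k X
      assume "lam < 0" "0 < x0" "0 < k" "implicit_scheme \<alpha> lam k x0 X"
      then show "X \<longlonglongrightarrow> 0" by (intro implicit_scheme_tendsto_0[OF \<alpha> \<open>0 < k\<close> \<open>lam < 0\<close> \<open>0 < x0\<close>])
    qed
  next
    show "lam > 0 \<longrightarrow> (\<forall>x0>0. \<forall>k1>0. \<forall>k2>0. \<forall>m1::nat. \<forall>X1 X2.
        k1 powr \<alpha> * lam < coeff_c \<alpha> 0 \<longrightarrow> k2 powr \<alpha> * lam < coeff_c \<alpha> 0 \<longrightarrow>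
        k1 = 2 ^ m1 * k2 \<longrightarrow>
        implicit_scheme \<alpha> lam k1 x0 X1 \<longrightarrow> implicit_scheme \<alpha> lam k2 x0 X2 \<longrightarrow>
        (\<forall>t>0. pw_const k1 X1 t \<ge> pw_const k2 X2 t))"
    proof (intro impI allI)
      fix x0 k1 k2 t :: real and m1 :: nat and X1 X2
      assume "0 < lam" "0 < x0" "0 < k2" "k1 powr \<alpha> * lam < coeff_c \<alpha> 0" "k2 powr \<alpha> * lam < coeff_c \<alpha> 0"
        "k1 = 2 ^ m1 * k2" "implicit_scheme \<alpha> lam k1 x0 X1" "implicit_scheme \<alpha> lam k2 x0 X2" "0 < t"
      then show "pw_const k2 X2 t \<le> pw_const k1 X1 t"
        by (intro pw_const_refine_le[OF \<alpha>, where N="2 ^ m1"]) auto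
    qed
  next
    show "lam > 0 \<longrightarrow> (\<forall>T>0. \<exists>C>0. \<forall>x0>0. \<forall>k>0. \<forall>X.
        k powr \<alpha> * lam \<le> 1 / 2 * coeff_c \<alpha> 0 \<longrightarrow> implicit_scheme \<alpha> lam k x0 X \<longrightarrow>
        (SUP n\<in>{n. real n * k \<le> T}. X n) \<le> C * X 0)"
      by (intro impI allI implicit_scheme_bound[OF \<alpha>])
  next
    show "\<forall>x0>0. \<forall>T>0. \<exists>C1. \<forall>\<^sub>F k in at_right 0. \<forall>X. implicit_scheme \<alpha> lam k x0 X \<longrightarrow>
        (SUP n\<in>{n. real n * k \<le> T}. \<bar>X n - exact_sol \<alpha> lam x0 (real n * k)\<bar>) \<le> C1 * k powr \<alpha>"
      by (intro impI allI implicit_scheme_error[OF \<alpha>])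
  qed
qed

end
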